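(* For all $i,j\in\{1,2\}$, $1\le n\le N$ and gauge parameters $\alpha,\beta,\gamma,\delta$, the local operators $E_n^{i,j}(\xi_n|\cdot,\cdot)$ can be reconstructed as $$E_n^{i,j}(\xi_n|(\alpha,\beta),(\gamma,\delta))=\prod_{k=1}^{n-1}t(\xi_k-\eta/2)\ M_{j,i}(\xi_n-\eta/2|(\alpha,\beta),(\gamma,\delta))\ \prod_{k=1}^n[t(\xi_k-\eta/2)]^{-1},$$ and $$\begin{aligned}E_n^{i,j}(\xi_n|(\gamma,\delta),(\alpha,\beta))&=(-1)^N\prod_{k=1}^nt(\xi_k-\eta/2)\ \frac{\hat M_{j,i}(-\eta/2-\xi_n|(\alpha,\beta),(\gamma,\delta))}{\det_qM(\xi_n)}\ \prod_{k=1}^{n-1}[t(\xi_k-\eta/2)]^{-1}\\&=(-1)^{i-j}\frac{\det S(-\xi_n|\alpha,\beta)}{\det S(-\xi_n|\gamma,\delta)}\prod_{k=1}^nt(\xi_k-\eta/2)\ \frac{M_{3-i,3-j}(\xi_n+\eta/2|(\alpha-1,\beta),(\gamma-1,\delta))}{\det_qM(\xi_n)}\ \prod_{k=1}^{n-1}[t(\xi_k-\eta/2)]^{-1}.\end{aligned}$$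
   Context: $N\ge1$, $\sinh\eta\neq0$, $\mathcal H=\otimes_{n=1}^N\mathcal H_n$, $\mathcal H_n=\mathbb C^2$, $\xi_1,\dots,\xi_N$ generic ($\xi_j,\xi_j\pm\xi_k\notin\{0,\pm\eta\}+i\pi\mathbb Z$, $j\ne k$). $\bar R(\lambda)\in\mathrm{End}(\mathbb C^2\otimes\mathbb C^2)$ has (basis $++,+-,-+,--$) diagonal $(\sinh(\lambda-\eta),\sinh\lambda,\sinh\lambda,\sinh(\lambda-\eta))$, entries $(+-,-+)$ and $(-+,+-)$ equal to $-\sinh\eta$, zeros elsewhere. $M_0(\lambda)=\bar R_{0N}(\lambda-\xi_N+\eta/2)\cdots\bar R_{01}(\lambda-\xi_1+\eta/2)$, $\hat M_0(\lambda)=(-1)^N\sigma_0^yM_0^{t_0}(-\lambda)\sigma_0^y$, $t(\lambda)=\mathrm{tr}_0[M_0(\lambda)]$ (bulk transfer matrices, which commute), $\det_qM(\lambda)=a(\lambda+\eta/2)d(\lambda-\eta/2)$ with $a(\lambda)=\prod_n\sinh(\lambda-\xi_n+\eta/2)$, $d(\lambda)=\prod_n\sinh(\lambda-\xi_n-\eta/2)$. $S(\lambda|\alpha,\beta)=\begin{pmatrix}e^{\lambda-\eta(\beta+\alpha)}&e^{\lambda+\eta(\beta-\alpha)}\\1&1\end{pmatrix}$ (assumed invertible for all gauge parameters used, i.e. $\sinh(\eta\beta)\ne0$, $\sinh(\eta\delta)\neq0$). Gauged monodromy matrices: $M(\lambda|(\alpha,\beta),(\gamma,\delta))=S_0^{-1}(-\eta/2-\lambda|\alpha,\beta)M_0(\lambda)S_0(-\eta/2-\lambda|\gamma,\delta)$,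 $\hat M(\lambda|(\alpha,\beta),(\gamma,\delta))=S_0^{-1}(\lambda+\eta/2|\gamma,\delta)\hat M_0(\lambda)S_0(\lambda+\eta/2|\alpha,\beta)$; $M_{j,i}$, $\hat M_{j,i}$ denote their matrix entries (row $j$, column $i$) in the auxiliary space $0$. Local operators: $E_n^{i,j}(\lambda|(\alpha,\beta),(\gamma,\delta))=S_n(-\lambda|\gamma,\delta)\,E_n^{i,j}\,S_n^{-1}(-\lambda|\alpha,\beta)$, $E^{i,j}$ the elementary $2\times2$ matrix. *)

theory Defs
  imports
    Complex_Main
    "Jordan_Normal_Form.Determinant"
    "Jordan_Normal_Form.Gauss_Jordan_Elimination"
begin

text \<open>
  The quantum space \<open>H = H_1 \<otimes> \<dots> \<otimes> H_N\<close> and the extended space \<open>H_0 \<otimes> H\<close>, with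
  \<open>H_0\<close> the auxiliary space, are \<open>\<complex>^(2^N)\<close> and \<open>\<complex>^(2^(N+1))\<close>. Operators are square matrices
  of these sizes in the tensor product basis, ordered lexicographically with the lowest-numbered
  factor most significant; the basis vectors \<open>+\<close> and \<open>-\<close> of each factor are the digits 0 and 1.
  The function \<open>spin N n\<close> reads off the digit of the factor \<open>n\<close>. It serves both spaces: for an
  index below \<open>2^N\<close> the digit of the factor 0 is 0.
\<close>

definition spin :: "nat \<Rightarrow> nat \<Rightarrow> nat \<Rightarrow> nat" where
  "spin N n k = (k div 2 ^ (N - n)) mod 2"

text \<open>
  \<open>site_op N D n A\<close> is the 2 by 2 matrix \<open>A\<close> acting in the factor \<open>n\<close>, and
  \<open>two_site_op N D m n X\<close> is the 4 by 4 matrix \<open>X\<close> (basis \<open>++, +-, -+, --\<close>) acting in the factors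
  \<open>m, n\<close>, in this order. The dimension \<open>D\<close> is \<open>2^N\<close> on \<open>H\<close> and \<open>2^(N+1)\<close> on \<open>H_0 \<otimes> H\<close>.
\<close>

definition site_op :: "nat \<Rightarrow> nat \<Rightarrow> nat \<Rightarrow> complex mat \<Rightarrow> complex mat" where
  "site_op N D n A = mat D D (\<lambda>(r, c).
     if \<forall>k\<in>{0..N} - {n}. spin N k r = spin N k c
     then A $$ (spin N n r, spin N n c) else 0)"

definition two_site_op :: "nat \<Rightarrow> nat \<Rightarrow> nat \<Rightarrow> nat \<Rightarrow> complex mat \<Rightarrow> complex mat" where
  "two_site_op N D m n X = mat D D (\<lambda>(r, c).
     if \<forall>k\<in>{0..N} - {m, n}. spin N k r = spin N k c
     then X $$ (2 * spin N m r + spin N n r, 2 * spin N m c + spin N n c) else 0)"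

text \<open>Ordered product, leftmost factor first, and inverse (meaningful for invertible matrices).\<close>

definition mat_prod :: "nat \<Rightarrow> complex mat list \<Rightarrow> complex mat" where
  "mat_prod D As = foldr (*) As (1\<^sub>m D)"

definition minv :: "complex mat \<Rightarrow> complex mat" where
  "minv A = the (mat_inverse A)"

text \<open>
  For \<open>A\<close> on \<open>H_0 \<otimes> H\<close>: the entry of \<open>A\<close> in row \<open>j\<close> and column \<open>i\<close> (both 1 or 2) of the
  auxiliary space, which is an operator on \<open>H\<close>; the trace over \<open>H_0\<close>; the transpose in \<open>H_0\<close>.
\<close>

definition aux_entry :: "nat \<Rightarrow> complex mat \<Rightarrow> nat \<Rightarrow> nat \<Rightarrow> complex mat" where
  "aux_entry N A j i = mat (2 ^ N) (2 ^ N) (\<lambda>(r, c). A $$ ((j - 1) * 2 ^ N + r, (i - 1) * 2 ^ N + c))"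

definition aux_trace :: "nat \<Rightarrow> complex mat \<Rightarrow> complex mat" where
  "aux_trace N A = aux_entry N A 1 1 + aux_entry N A 2 2"

definition aux_transpose :: "nat \<Rightarrow> complex mat \<Rightarrow> complex mat" where
  "aux_transpose N A = mat (2 ^ (N + 1)) (2 ^ (N + 1)) (\<lambda>(r, c).
     A $$ (spin N 0 c * 2 ^ N + r mod 2 ^ N, spin N 0 r * 2 ^ N + c mod 2 ^ N))"

definition Rbar :: "complex \<Rightarrow> complex \<Rightarrow> complex mat" where
  "Rbar \<eta> l = mat_of_rows_list 4
     [[sinh (l - \<eta>), 0, 0, 0],
      [0, sinh l, - sinh \<eta>, 0],
      [0, - sinh \<eta>, sinh l, 0],
      [0, 0, 0, sinh (l - \<eta>)]]"

definition sigma_y :: "complex mat" where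
  "sigma_y = mat_of_rows_list 2 [[0, - \<i>], [\<i>, 0]]"

definition monodromy :: "complex \<Rightarrow> (nat \<Rightarrow> complex) \<Rightarrow> nat \<Rightarrow> complex \<Rightarrow> complex mat" where
  "monodromy \<eta> \<xi> N l = mat_prod (2 ^ (N + 1))
     (map (\<lambda>n. two_site_op N (2 ^ (N + 1)) 0 n (Rbar \<eta> (l - \<xi> n + \<eta> / 2))) (rev [1..<N + 1]))"

definition monodromy_hat :: "complex \<Rightarrow> (nat \<Rightarrow> complex) \<Rightarrow> nat \<Rightarrow> complex \<Rightarrow> complex mat" where
  "monodromy_hat \<eta> \<xi> N l = (-1) ^ N \<cdot>\<^sub>m
     (site_op N (2 ^ (N + 1)) 0 sigma_y * aux_transpose N (monodromy \<eta> \<xi> N (- l))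
        * site_op N (2 ^ (N + 1)) 0 sigma_y)"

definition transfer :: "complex \<Rightarrow> (nat \<Rightarrow> complex) \<Rightarrow> nat \<Rightarrow> complex \<Rightarrow> complex mat" where
  "transfer \<eta> \<xi> N l = aux_trace N (monodromy \<eta> \<xi> N l)"

definition a_fun :: "complex \<Rightarrow> (nat \<Rightarrow> complex) \<Rightarrow> nat \<Rightarrow> complex \<Rightarrow> complex" where
  "a_fun \<eta> \<xi> N l = (\<Prod>n\<in>{1..N}. sinh (l - \<xi> n + \<eta> / 2))"

definition d_fun :: "complex \<Rightarrow> (nat \<Rightarrow> complex) \<Rightarrow> nat \<Rightarrow> complex \<Rightarrow> complex" where
  "d_fun \<eta> \<xi> N l = (\<Prod>n\<in>{1..N}. sinh (l - \<xi> n - \<eta> / 2))"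

definition detq :: "complex \<Rightarrow> (nat \<Rightarrow> complex) \<Rightarrow> nat \<Rightarrow> complex \<Rightarrow> complex" where
  "detq \<eta> \<xi> N l = a_fun \<eta> \<xi> N (l + \<eta> / 2) * d_fun \<eta> \<xi> N (l - \<eta> / 2)"

text \<open>The gauge matrix \<open>S(l|\<alpha>,\<beta>)\<close>; pairs of gauge parameters are passed as two arguments.\<close>

definition gauge :: "complex \<Rightarrow> complex \<Rightarrow> complex \<Rightarrow> complex \<Rightarrow> complex mat" where
  "gauge \<eta> l \<alpha> \<beta> = mat_of_rows_list 2
     [[exp (l - \<eta> * (\<beta> + \<alpha>)), exp (l + \<eta> * (\<beta> - \<alpha>))],
      [1, 1]]"

definition gauged_monodromy :: "complex \<Rightarrow> (nat \<Rightarrow> complex) \<Rightarrow> nat \<Rightarrow> complex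
    \<Rightarrow> complex \<times> complex \<Rightarrow> complex \<times> complex \<Rightarrow> complex mat" where
  "gauged_monodromy \<eta> \<xi> N l = (\<lambda>(\<alpha>, \<beta>) (\<gamma>, \<delta>).
     site_op N (2 ^ (N + 1)) 0 (minv (gauge \<eta> (- \<eta> / 2 - l) \<alpha> \<beta>))
       * monodromy \<eta> \<xi> N l
       * site_op N (2 ^ (N + 1)) 0 (gauge \<eta> (- \<eta> / 2 - l) \<gamma> \<delta>))"

definition gauged_monodromy_hat :: "complex \<Rightarrow> (nat \<Rightarrow> complex) \<Rightarrow> nat \<Rightarrow> complex
    \<Rightarrow> complex \<times> complex \<Rightarrow> complex \<times> complex \<Rightarrow> complex mat" where
  "gauged_monodromy_hat \<eta> \<xi> N l = (\<lambda>(\<alpha>, \<beta>) (\<gamma>, \<delta>).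
     site_op N (2 ^ (N + 1)) 0 (minv (gauge \<eta> (l + \<eta> / 2) \<gamma> \<delta>))
       * monodromy_hat \<eta> \<xi> N l
       * site_op N (2 ^ (N + 1)) 0 (gauge \<eta> (l + \<eta> / 2) \<alpha> \<beta>))"

definition elem_mat :: "nat \<Rightarrow> nat \<Rightarrow> complex mat" where
  "elem_mat i j = mat 2 2 (\<lambda>(r, c). if r = i - 1 \<and> c = j - 1 then 1 else 0)"

definition gauged_elem :: "complex \<Rightarrow> nat \<Rightarrow> nat \<Rightarrow> nat \<Rightarrow> nat \<Rightarrow> complex
    \<Rightarrow> complex \<times> complex \<Rightarrow> complex \<times> complex \<Rightarrow> complex mat" where
  "gauged_elem \<eta> N n i j l = (\<lambda>(\<alpha>, \<beta>) (\<gamma>, \<delta>).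
     site_op N (2 ^ N) n (gauge \<eta> (- l) \<gamma> \<delta>)
       * site_op N (2 ^ N) n (elem_mat i j)
       * site_op N (2 ^ N) n (minv (gauge \<eta> (- l) \<alpha> \<beta>)))"

text \<open>
  The products of \<open>t(\<xi>_k - \<eta>/2)\<close> and of their inverses over \<open>k = 1, \<dots>, m\<close>, both taken with \<open>k\<close>
  increasing from left to right; the order is immaterial, since the transfer matrices commute.
\<close>

definition transfer_prod :: "complex \<Rightarrow> (nat \<Rightarrow> complex) \<Rightarrow> nat \<Rightarrow> nat \<Rightarrow> complex mat" where
  "transfer_prod \<eta> \<xi> N m =
     mat_prod (2 ^ N) (map (\<lambda>k. transfer \<eta> \<xi> N (\<xi> k - \<eta> / 2)) [1..<m + 1])"

definition transfer_inv_prod :: "complex \<Rightarrow> (nat \<Rightarrow> complex) \<Rightarrow> nat \<Rightarrow> nat \<Rightarrow> complex mat" where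
  "transfer_inv_prod \<eta> \<xi> N m =
     mat_prod (2 ^ N) (map (\<lambda>k. minv (transfer \<eta> \<xi> N (\<xi> k - \<eta> / 2))) [1..<m + 1])"

text \<open>The set \<open>{0, \<eta>, -\<eta>} + \<i>\<pi>\<int>\<close>.\<close>

definition excluded :: "complex \<Rightarrow> complex set" where
  "excluded \<eta> = {z + \<i> * of_real pi * of_int m | z m. z \<in> {0, \<eta>, - \<eta>}}"

definition generic_inhom :: "complex \<Rightarrow> (nat \<Rightarrow> complex) \<Rightarrow> nat \<Rightarrow> bool" where
  "generic_inhom \<eta> \<xi> N \<longleftrightarrow>
     (\<forall>j\<in>{1..N}. \<xi> j \<notin> excluded \<eta>) \<and>
     (\<forall>j\<in>{1..N}. \<forall>k\<in>{1..N}. j \<noteq> k \<longrightarrow> \<xi> j + \<xi> k \<notin> excluded \<eta> \<and> \<xi> j - \<xi> k \<notin> excluded \<eta>)"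

end

theory Submission
  imports Defs
begin

text \<open>
  Write \<open>R_jk\<close> for the R-matrix in the sites \<open>j, k\<close> at \<open>\<xi>_j - \<xi>_k\<close>. At \<open>\<xi>_n - \<eta>/2\<close> the factor of the
  monodromy matrix at the site \<open>n\<close> is a multiple of the permutation of the sites \<open>0\<close> and \<open>n\<close>. Pulling
  it through the other factors gives, for a matrix \<open>A\<close> and up to a scalar,
  \<open>tr_0 (A_0 M_0) = K_n A_n L_n\<close> with \<open>K_n = R_n,n-1 ... R_n1\<close> and \<open>L_n = R_nN ... R_n,n+1\<close>, in particular
  \<open>t_n = K_n L_n\<close>. By unitarity \<open>t_1 ... t_(n-1) K_n\<close> telescopes to the product over \<open>j < n\<close> of
  \<open>R_jN ... R_j,n+1\<close>, which does not involve the site \<open>n\<close> and so commutes with \<open>A_n\<close>. This is the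
  first reconstruction formula. By crossing symmetry \<open>\<sigma>\<^sup>y M\<^sup>t \<sigma>\<^sup>y\<close> at \<open>\<xi>_n + \<eta>/2\<close> is a product of
  R-matrices at the opposite arguments, which gives \<open>L_n\<^sup>-\<^sup>1 A_n K_n\<^sup>-\<^sup>1\<close> and the second formula. The third
  one is the same statement read entrywise, since \<open>\<sigma>\<^sup>y S\<^sup>t \<sigma>\<^sup>y\<close> is the adjugate of \<open>S\<close>. The Yang-Baxter
  equation only enters through the commutation of \<open>t_n\<close> with \<open>t_1 ... t_(n-1)\<close>, which turns the
  inverse products into the stated order.
\<close>

section \<open>Exchange relations in a monoid\<close>


lemma prod_list_commute:
  fixes x :: "'a :: monoid_mult"
  assumes "\<And>y. y \<in> set ys \<Longrightarrow> x * y = y * x"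
  shows "x * prod_list ys = prod_list ys * x"
  using assms
proof (induction ys)
  case (Cons y ys)
  have "x * prod_list (y # ys) = y * (x * prod_list ys)"
    using Cons.prems[of y] by (simp add: mult.assoc[symmetric])
  then show ?case using Cons by (simp add: mult.assoc)
qed simp

text \<open>Products are normalised to the right, so a relation between the leading factors must
  carry the tail \<open>z\<close> in order to rewrite inside a longer product.\<close>

lemma mult_extend2: "a * b = c \<Longrightarrow> a * (b * z) = c * z"
  and mult_extend3: "a * b * c' = d \<Longrightarrow> a * (b * (c' * z)) = d * z"
  for a b c c' d z :: "'a :: monoid_mult"
  by (simp_all add: mult.assoc[symmetric])

text \<open>\<open>r j k\<close> stands for the R-matrix in the sites \<open>j\<close>,
  \<open>k\<close> at \<xi>_j - \<xi>_k, scaled so that unitarity has no scalar. The sites determine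
  the spectral parameters, which therefore do not appear in the relations.\<close>

locale exchange_relations =
  fixes r :: "nat \<Rightarrow> nat \<Rightarrow> 'a :: monoid_mult" and I :: "nat set"
  assumes unitarity: "\<lbrakk>j \<in> I; k \<in> I; j \<noteq> k\<rbrakk> \<Longrightarrow> r j k * r k j = 1"
    and disjoint_commute: "\<lbrakk>{j, k, l, m} \<subseteq> I; j \<noteq> k; l \<noteq> m; {j, k} \<inter> {l, m} = {}\<rbrakk>
      \<Longrightarrow> r j k * r l m = r l m * r j k"
    and yang_baxter: "\<lbrakk>{n, j, k} \<subseteq> I; distinct [n, j, k]\<rbrakk>
      \<Longrightarrow> r n j * r n k * r j k = r j k * r n k * r n j"
begin

section \<open>Rows and columns of R-matrices, and their exchange\<close>

definition row :: "nat \<Rightarrow> nat list \<Rightarrow> 'a" where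
  "row j ks = prod_list (map (r j) ks)"

definition column :: "nat list \<Rightarrow> nat \<Rightarrow> 'a" where
  "column ks j = prod_list (map (\<lambda>k. r k j) ks)"

lemma row_simps [simp]:
  "row j [] = 1" "row j (k # ks) = r j k * row j ks" "row j (ks @ ls) = row j ks * row j ls"
  "column [] j = 1" "column (k # ks) j = r k j * column ks j"
  "column (ks @ ls) j = column ks j * column ls j"
  by (simp_all add: row_def column_def)

text \<open>The adjacent factors \<open>r j k\<close> and \<open>r k j\<close> cancel by unitarity,
  which brings the next pair together. This supplies the inverses of rows.\<close>

lemma row_column:
  assumes "set ks \<subseteq> I - {j}" "j \<in> I"
  shows "row j (rev ks) * column ks j = 1" "column ks j * row j (rev ks) = 1"
proof -
  have *: "x * (r j k * (r k j * y)) = x * y" "x * (r k j * (r j k * y)) = x * y"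
    if "k \<in> I - {j}" for k x y
    using that assms(2) unitarity[of j k, THEN mult_extend2] unitarity[of k j, THEN mult_extend2]
    by simp_all
  show "row j (rev ks) * column ks j = 1"
    using assms(1) by (induction ks) (auto simp: mult.assoc *)
  have "column (rev ks) j * row j ks = 1"
    using assms(1) by (induction ks) (auto simp: mult.assoc *)
  moreover have "column ks j * row j (rev ks) = 1" if "set ks \<subseteq> I - {j}" for ks
    using that by (induction ks rule: rev_induct) (auto simp: mult.assoc *)
  ultimately show "column ks j * row j (rev ks) = 1"
    using assms(1) by blast
qed

lemma r_row_commute:
  assumes "set ks \<subseteq> I - {l, j, k}" "{l, j, k} \<subseteq> I" "distinct [l, j, k]"
  shows "r j k * row l ks = row l ks * r j k"
  unfolding row_def using assms by (intro prod_list_commute) (auto intro!: disjoint_commute)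

text \<open>The Yang-Baxter equation is applied once for each site \<open>k\<close> in
  \<open>ks\<close>: \<open>r n j\<close> passes one pair \<open>r n k\<close>, \<open>r j k\<close>
  at a time and swaps it.\<close>

lemma row_row_exchange:
  assumes "set ks \<subseteq> I - {n, j}" "distinct ks" "{n, j} \<subseteq> I" "n \<noteq> j"
  shows "r n j * row n ks * row j ks = row j ks * row n ks * r n j"
  using assms
proof (induction ks)
  case (Cons k ks)
  have IH: "r n j * (row n ks * row j ks) = row j ks * (row n ks * r n j)"
    using Cons by (simp add: mult.assoc)
  have 1: "row n ks * r j k = r j k * row n ks"
    using Cons.prems by (intro r_row_commute[symmetric]) auto
  have 2: "r n k * row j ks = row j ks * r n k"
    using Cons.prems by (intro r_row_commute) auto
  have 3: "r n j * r n k * r j k = r j k * r n k * r n j"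
    using Cons.prems by (intro yang_baxter) auto
  \<comment> \<open>\<open>r j k\<close> is first brought next to \<open>r n k\<close>; the row in
    between involves only \<open>n\<close> and \<open>ks\<close>, hence neither \<open>j\<close> nor
    \<open>k\<close>.\<close>
  have "r n j * row n (k # ks) * row j (k # ks) = r n j * r n k * (row n ks * r j k) * row j ks"
    by (simp add: mult.assoc)
  also have "\<dots> = (r n j * r n k * r j k) * (row n ks * row j ks)"
    by (simp only: mult_extend2[OF 1] 1 mult.assoc)
  also have "\<dots> = r j k * r n k * (r n j * (row n ks * row j ks))"
    by (simp only: mult_extend3[OF 3] mult.assoc)
  also have "\<dots> = r j k * (r n k * row j ks) * (row n ks * r n j)"
    by (simp only: IH mult.assoc)
  also have "\<dots> = row j (k # ks) * row n (k # ks) * r n j"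
    by (simp only: 2) (simp add: mult.assoc)
  finally show ?case .
qed simp

definition rows :: "nat list \<Rightarrow> nat list \<Rightarrow> 'a" where
  "rows js ks = prod_list (map (\<lambda>j. row j ks) js)"

lemma rows_simps [simp]: "rows [] ks = 1" "rows (j # js) ks = row j ks * rows js ks"
  "rows (js @ js') ks = rows js ks * rows js' ks"
  by (simp_all add: rows_def)

lemma r_rows_commute:
  assumes "set ks \<subseteq> I" "set js \<subseteq> I" "{j, k} \<subseteq> I" "j \<noteq> k" "set js \<inter> set ks = {}"
    "{j, k} \<inter> (set js \<union> set ks) = {}"
  shows "r j k * rows js ks = rows js ks * r j k"
  unfolding rows_def using assms by (intro prod_list_commute) (auto intro!: r_row_commute)

text \<open>The columns pair up from the inside out, each pair cancelling by unitarity.\<close>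

lemma rows_snoc_row:
  assumes "set ks \<subseteq> I" "set js \<subseteq> I" "n \<in> I" "distinct js" "set js \<inter> set ks = {}"
    "n \<notin> set js \<union> set ks"
  shows "rows js (ks @ [n]) * row n (rev js) = rows js ks"
  using assms
proof (induction js)
  case (Cons j js)
  have IH: "rows js (ks @ [n]) * row n (rev js) = rows js ks"
    using Cons by simp
  have 1: "r j n * rows js ks = rows js ks * r j n"
    using Cons.prems by (intro r_rows_commute) auto
  have 2: "r j n * r n j = 1"
    using Cons.prems by (intro unitarity) auto
  have "rows (j # js) (ks @ [n]) * row n (rev (j # js))
      = row j ks * r j n * (rows js (ks @ [n]) * row n (rev js)) * r n j"
    by (simp add: mult.assoc)
  also have "\<dots> = row j ks * (r j n * rows js ks) * r n j"
    by (simp only: IH mult.assoc)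
  also have "\<dots> = row j ks * rows js ks * (r j n * r n j)"
    by (simp only: mult_extend2[OF 1] mult.assoc)
  finally show ?case by (simp add: 2)
qed simp

text \<open>The last factor of \<open>row n (rev (j # js))\<close> is \<open>r n j\<close> and the
  first row of \<open>rows (j # js) ks\<close> is that of \<open>j\<close>.
  \<open>row_row_exchange\<close> applies to this pair, and the remaining rows follow by
  induction.\<close>

lemma row_row_rows_exchange:
  assumes "set ks \<subseteq> I" "set js \<subseteq> I" "n \<in> I" "distinct js" "distinct ks" "set js \<inter> set ks = {}"
    "n \<notin> set js \<union> set ks"
  shows "row n (rev js) * row n ks * rows js ks = rows js ks * row n ks * row n (rev js)"
  using assms
proof (induction js)
  case (Cons j js)
  have IH: "row n (rev js) * row n ks * rows js ks = rows js ks * row n ks * row n (rev js)"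
    using Cons by simp
  have 1: "r n j * rows js ks = rows js ks * r n j"
    using Cons.prems by (intro r_rows_commute) auto
  have 2: "r n j * row n ks * row j ks = row j ks * row n ks * r n j"
    using Cons.prems by (intro row_row_exchange) auto
  \<comment> \<open>The sites involved are disjoint: \<open>n\<close> and \<open>js\<close> in one
    factor, \<open>j\<close> and \<open>ks\<close> in the other.\<close>
  have 3: "row n (rev js) * row j ks = row j ks * row n (rev js)"
  proof -
    have "r n l * row j ks = row j ks * r n l" if "l \<in> set js" for l
      using that Cons.prems by (intro r_row_commute) auto
    then have "row j ks * r n l = r n l * row j ks" if "l \<in> set js" for l
      using that by simp
    then have "row j ks * row n (rev js) = row n (rev js) * row j ks"
      unfolding row_def[of n] by (intro prod_list_commute) auto
    then show ?thesis by simp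
  qed
  have "row n (rev (j # js)) * row n ks * rows (j # js) ks
      = row n (rev js) * (r n j * row n ks * row j ks) * rows js ks"
    by (simp add: mult.assoc)
  also have "\<dots> = (row n (rev js) * row j ks) * row n ks * (r n j * rows js ks)"
    by (simp only: mult_extend3[OF 2] mult.assoc)
  also have "\<dots> = row j ks * (row n (rev js) * row n ks * rows js ks) * r n j"
    by (simp only: 1 mult_extend2[OF 3] 3 mult.assoc)
  also have "\<dots> = rows (j # js) ks * row n ks * row n (rev (j # js))"
    by (simp only: IH) (simp add: mult.assoc)
  finally show ?case .
qed simp

end

section \<open>The chain of sites and the products of its transfer matrices\<close>

locale exchange_chain = exchange_relations r "{1..N}" for r :: "nat \<Rightarrow> nat \<Rightarrow> 'a :: monoid_mult" and N
begin

text \<open>\<open>lower n\<close> and \<open>upper n\<close> are K_n and L_n of the outline. Their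
  inverses reverse both the order of the sites and the two indices, as unitarity demands.\<close>

definition lower :: "nat \<Rightarrow> 'a" where "lower n = row n (rev [1..<n])"
definition upper :: "nat \<Rightarrow> 'a" where "upper n = row n (rev [n + 1..<N + 1])"
definition lower_inv :: "nat \<Rightarrow> 'a" where "lower_inv n = column [1..<n] n"
definition upper_inv :: "nat \<Rightarrow> 'a" where "upper_inv n = column [n + 1..<N + 1] n"

text \<open>Up to scalars these are the products of the transfer matrices and of their inverses.
  Both run in increasing order, so \<open>forward m * backward m\<close> does not cancel from the
  inside without commutation.\<close>

definition forward :: "nat \<Rightarrow> 'a" where
  "forward m = prod_list (map (\<lambda>k. lower k * upper k) [1..<m + 1])"
definition backward :: "nat \<Rightarrow> 'a" where
  "backward m = prod_list (map (\<lambda>k. upper_inv k * lower_inv k) [1..<m + 1])"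

lemma lower_upper_inverse:
  assumes "n \<in> {1..N}"
  shows "lower n * lower_inv n = 1" "lower_inv n * lower n = 1"
    "upper n * upper_inv n = 1" "upper_inv n * upper n = 1"
  unfolding lower_def upper_def lower_inv_def upper_inv_def
  using assms by (intro row_column; force)+

lemma forward_Suc: "forward (Suc m) = forward m * lower (Suc m) * upper (Suc m)"
  and backward_Suc: "backward (Suc m) = backward m * upper_inv (Suc m) * lower_inv (Suc m)"
  by (simp_all add: forward_def backward_def mult.assoc)

text \<open>Each of the first \<open>m\<close> rows ends with the site \<open>Suc m\<close>.
  \<open>lower (Suc m)\<close> cancels this column, and the site \<open>Suc m\<close> disappears
  from the product.\<close>

lemma forward_lower_aux:
  assumes "forward m = rows [1..<m + 1] (rev [m + 1..<N + 1])" "Suc m \<le> N"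
  shows "forward m * lower (Suc m) = rows [1..<m + 1] (rev [m + 2..<N + 1])"
proof -
  have "rev [m + 1..<N + 1] = rev [m + 2..<N + 1] @ [Suc m]"
    using assms(2) by (subst upt_conv_Cons) auto
  then have "forward m * lower (Suc m)
      = rows [1..<m + 1] (rev [m + 2..<N + 1] @ [Suc m]) * row (Suc m) (rev [1..<m + 1])"
    by (simp add: assms(1) lower_def)
  also have "\<dots> = rows [1..<m + 1] (rev [m + 2..<N + 1])"
    using assms(2) by (intro rows_snoc_row) auto
  finally show ?thesis .
qed

text \<open>Once \<open>lower (Suc m)\<close> has cancelled the column of \<open>Suc m\<close>, the
  remaining factor \<open>upper (Suc m)\<close> is exactly the next row.\<close>

lemma forward_eq_rows: "m \<le> N \<Longrightarrow> forward m = rows [1..<m + 1] (rev [m + 1..<N + 1])"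
proof (induction m)
  case (Suc m)
  then show ?case
    using forward_lower_aux[of m] by (simp add: forward_Suc upper_def del: upt_Suc) (simp add: mult.assoc)
qed (simp add: forward_def)

lemma forward_lower:
  assumes "n \<in> {1..N}"
  shows "forward (n - 1) * lower n = rows [1..<n] (rev [n + 1..<N + 1])"
proof -
  obtain m where "n = Suc m" using assms by (cases n) auto
  then show ?thesis
    using forward_lower_aux[of m] forward_eq_rows[of m] assms by (simp del: upt_Suc)
qed

text \<open>This is the commutation of t_n with t_1 ... t_(n-1). Both sides are expressed through
  \<open>?X\<close>, which is free of the site \<open>n\<close>; moving
  \<open>lower n * upper n\<close> through it interchanges these two factors, and
  \<open>lower_inv n\<close> then cancels \<open>lower n\<close>.\<close>

lemma forward_commute:
  assumes "n \<in> {1..N}"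
  shows "lower n * upper n * forward (n - 1) = forward n"
proof -
  let ?X = "rows [1..<n] (rev [n + 1..<N + 1])"
  have X: "forward (n - 1) = ?X * lower_inv n"
    using forward_lower[OF assms] lower_upper_inverse(1)[OF assms]
    by (metis mult.assoc mult_1_right)
  have "lower n * upper n * ?X = ?X * upper n * lower n"
    unfolding lower_def upper_def using assms by (intro row_row_rows_exchange) auto
  then have "lower n * upper n * forward (n - 1) = ?X * upper n * (lower n * lower_inv n)"
    by (simp only: X mult.assoc[symmetric])
  also have "\<dots> = forward (n - 1) * lower n * upper n"
    using forward_lower[OF assms] lower_upper_inverse(1)[OF assms] by (simp del: upt_Suc)
  finally show ?thesis using forward_Suc[of "n - 1"] assms by simp
qed

text \<open>The new factor is moved to the front of \<open>forward (Suc m)\<close> by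
  \<open>forward_commute\<close>, so that it encloses \<open>forward m * backward m\<close>, with
  its inverse at the other end.\<close>

lemma forward_backward: "m \<le> N \<Longrightarrow> forward m * backward m = 1"
proof (induction m)
  case (Suc m)
  have "forward (Suc m) * backward (Suc m) = lower (Suc m) * upper (Suc m) * (forward m * backward m)
      * upper_inv (Suc m) * lower_inv (Suc m)"
    using forward_commute[of "Suc m"] Suc.prems by (simp add: backward_Suc mult.assoc[symmetric])
  also have "\<dots> = lower (Suc m) * (upper (Suc m) * upper_inv (Suc m)) * lower_inv (Suc m)"
    using Suc by (simp add: mult.assoc)
  finally show ?case using Suc.prems lower_upper_inverse[of "Suc m"] by simp
qed (simp add: forward_def backward_def)

text \<open>The operator \<open>A\<close> at the site \<open>n\<close> only has to cross
  \<open>forward (n - 1) * lower n\<close>, whose factors avoid \<open>n\<close>. In the second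
  formula the final factor \<open>upper n\<close> of \<open>forward n\<close> first cancels
  \<open>upper_inv n\<close>.\<close>

lemma local_operator_reconstruction:
  assumes n: "n \<in> {1..N}"
    and local: "\<And>j k. \<lbrakk>{j, k} \<subseteq> {1..N} - {n}; j \<noteq> k\<rbrakk> \<Longrightarrow> A * r j k = r j k * A"
  shows "forward (n - 1) * (lower n * A * upper n) * backward n = A"
    and "forward n * (upper_inv n * A * lower_inv n) * backward (n - 1) = A"
proof -
  let ?X = "rows [1..<n] (rev [n + 1..<N + 1])"
  have row: "A * row j (rev [n + 1..<N + 1]) = row j (rev [n + 1..<N + 1]) * A" if "j \<in> {1..<n}" for j
    unfolding row_def using that n by (intro prod_list_commute) (auto intro!: local)
  have "A * ?X = ?X * A"
    unfolding rows_def by (intro prod_list_commute) (auto simp del: upt_Suc intro!: row[simplified])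
  then have comm: "forward (n - 1) * lower n * A = A * (forward (n - 1) * lower n)"
    by (simp only: forward_lower[OF n])
  have Fn: "forward (n - 1) * lower n * upper n = forward n"
    using forward_Suc[of "n - 1"] n by simp
  have "forward (n - 1) * (lower n * A * upper n) * backward n
      = A * (forward (n - 1) * lower n * upper n * backward n)"
    using comm by (simp add: mult.assoc[symmetric])
  then show "forward (n - 1) * (lower n * A * upper n) * backward n = A"
    using forward_backward[of n] n by (simp only: Fn) simp
  have "forward n * (upper_inv n * A * lower_inv n) * backward (n - 1)
      = forward (n - 1) * lower n * (upper n * upper_inv n) * A * lower_inv n * backward (n - 1)"
    by (simp add: Fn[symmetric] mult.assoc)
  also have "\<dots> = forward (n - 1) * lower n * A * lower_inv n * backward (n - 1)"
    by (simp only: lower_upper_inverse[OF n] mult_1_right)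
  also have "\<dots> = A * forward (n - 1) * (lower n * lower_inv n) * backward (n - 1)"
    by (simp only: mult_extend3[OF comm] mult.assoc)
  also have "\<dots> = A"
    using lower_upper_inverse[OF n] forward_backward[of "n - 1"] n by (auto simp add: mult.assoc)
  finally show "forward n * (upper_inv n * A * lower_inv n) * backward (n - 1) = A" .
qed

end


section \<open>R-matrices on spin configurations\<close>

text \<open>The spin of the site \<open>n\<close> is bit \<open>N - n\<close> of the index, so
  changing it is a bit operation, and identities between such changes are checked bit by
  bit.\<close>

definition put_spin :: "nat \<Rightarrow> nat \<Rightarrow> nat \<Rightarrow> nat \<Rightarrow> nat" where
  "put_spin N n p r = (if p = 0 then unset_bit (N - n) r else set_bit (N - n) r)"

lemma spin_eq_bit: "spin N n r = of_bool (bit r (N - n))"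
  by (simp add: spin_def bit_iff_odd mod2_eq_if)

lemma spin_cases: "spin N n r = 0 \<or> spin N n r = 1"
  by (simp add: spin_eq_bit)

lemma spin_less_2 [simp]: "spin N n r < 2"
  by (simp add: spin_eq_bit)

lemma bit_put_spin: "bit (put_spin N n p r) m \<longleftrightarrow> (if m = N - n then p \<noteq> 0 else bit r m)"
  by (auto simp: put_spin_def bit_simps)

lemma spin_put_spin_same: "p < 2 \<Longrightarrow> spin N n (put_spin N n p r) = p"
  by (auto simp: spin_eq_bit bit_put_spin)

lemma spin_put_spin_other: "\<lbrakk>k \<le> N; n \<le> N; k \<noteq> n\<rbrakk> \<Longrightarrow> spin N k (put_spin N n p r) = spin N k r"
  by (auto simp: spin_eq_bit bit_put_spin)

lemma spin_put_spin: "\<lbrakk>k \<le> N; n \<le> N; p < 2\<rbrakk>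
  \<Longrightarrow> spin N k (put_spin N n p r) = (if k = n then p else spin N k r)"
  by (simp add: spin_put_spin_same spin_put_spin_other)

lemma put_spin_put_spin: "put_spin N n p (put_spin N n q r) = put_spin N n p r"
  by (rule bit_eqI) (simp add: bit_put_spin)

lemma put_spin_commute: "\<lbrakk>k \<le> N; n \<le> N; k \<noteq> n\<rbrakk>
  \<Longrightarrow> put_spin N k p (put_spin N n q r) = put_spin N n q (put_spin N k p r)"
  by (rule bit_eqI) (auto simp add: bit_put_spin)

lemma put_spin_trivial: "spin N n r = p \<Longrightarrow> put_spin N n p r = r"
  by (rule bit_eqI) (auto simp add: bit_put_spin spin_eq_bit)

lemma bit_nat_less: 
  fixes r :: nat assumes "r < 2 ^ L" "bit r m" shows "m < L"
proof (rule ccontr)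
  assume "\<not> m < L"
  then have "(2::nat) ^ L \<le> 2 ^ m" by (intro power_increasing) auto
  with assms(1) have "r < 2 ^ m" by (rule order.strict_trans2)
  with assms(2) show False by (simp add: bit_iff_odd)
qed

text \<open>All four follow from the product-to-sum formula for \<open>sinh\<close>. The first three
  are the scalar content of the Yang-Baxter equation, the fourth that of unitarity.\<close>

lemma sinh_products:
  fixes x y z :: complex
  shows "sinh x * sinh y - sinh (x - z) * sinh (y - z) = sinh z * sinh (x + y - z)"
    and "sinh x * sinh z + sinh (x + y) * sinh (y - z) = sinh (x + y - z) * sinh y"
    and "sinh y * sinh z + sinh (x + y) * sinh (x - z) = sinh (x + y - z) * sinh x"
    and "sinh (x - z) * sinh (- x - z) = sinh z * sinh z - sinh x * sinh x"
proof -
  have *: "sinh u * sinh v = (cosh (u + v) - cosh (u - v)) / 2" for u v :: complex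
    by (simp add: cosh_add cosh_diff)
  \<comment> \<open>Arguments that differ by a sign are matched because \<open>cosh\<close> is
    even.\<close>
  have **: "cosh (u - v) = cosh (v - u)" for u v :: complex
    using cosh_minus[of "u - v"] by simp
  show "sinh x * sinh y - sinh (x - z) * sinh (y - z) = sinh z * sinh (x + y - z)"
    unfolding * using **[of "x + y" "2 * z"] **[of z "x + y - z"] by (simp add: field_simps)
  show "sinh x * sinh z + sinh (x + y) * sinh (y - z) = sinh (x + y - z) * sinh y"
    unfolding * by (simp add: field_simps)
  show "sinh y * sinh z + sinh (x + y) * sinh (x - z) = sinh (x + y - z) * sinh x"
    unfolding * by (simp add: field_simps)
  show "sinh (x - z) * sinh (- x - z) = sinh z * sinh z - sinh x * sinh x"
    unfolding * using cosh_minus[of "2 * z"] by (simp add: field_simps)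
qed

text \<open>The three shapes of the matrix elements of the Yang-Baxter equation between spin configurations
  that are not all equal.\<close>

lemma yang_baxter_elements:
  fixes x y z l l' h :: complex
  defines "a \<equiv> sinh l" and "a' \<equiv> sinh l'" and "A \<equiv> sinh (l + l')" and "c \<equiv> sinh h"
    and "b \<equiv> sinh (l - h)" and "b' \<equiv> sinh (l' - h)" and "B \<equiv> sinh (l + l' - h)"
  shows "a * (A * (b' * x) - c * (a' * y - c * z)) - c * (B * (a' * z - c * y))
      = b' * (A * (a * x - c * z) - c * (b * y))"
    and "b * (A * (a' * x - c * z) - c * (b' * y))
      = a' * (A * (b * x) - c * (a * y - c * z)) - c * (B * (a * z - c * y))"
    and "a * (B * (a' * x - c * z)) - c * (A * (b' * y) - c * (a' * z - c * x))
      = a' * (B * (a * x - c * y)) - c * (A * (b * z) - c * (a * y - c * x))"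
proof -
  have 1: "a * a' - b * b' = c * B" and 2: "a * c + A * b' = B * a'" and 3: "a' * c + A * b = B * a"
    unfolding a_def a'_def A_def c_def b_def b'_def B_def by (rule sinh_products)+
  \<comment> \<open>The terms in \<open>x\<close> cancel in the difference of the two sides, and the
    coefficients of \<open>c * y\<close> and \<open>c * z\<close> vanish by the relations 1 to 3;
    likewise below.\<close>
  have "a * (A * (b' * x) - c * (a' * y - c * z)) - c * (B * (a' * z - c * y))
      - b' * (A * (a * x - c * z) - c * (b * y))
      = c * y * (c * B - (a * a' - b * b')) + c * z * (a * c + A * b' - B * a')"
    by (simp add: algebra_simps)
  then show "a * (A * (b' * x) - c * (a' * y - c * z)) - c * (B * (a' * z - c * y))
      = b' * (A * (a * x - c * z) - c * (b * y))" by (simp add: 1 2)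
  have "b * (A * (a' * x - c * z) - c * (b' * y))
      - (a' * (A * (b * x) - c * (a * y - c * z)) - c * (B * (a * z - c * y)))
      = c * y * (a * a' - b * b' - c * B) + c * z * (B * a - (a' * c + A * b))"
    by (simp add: algebra_simps)
  then show "b * (A * (a' * x - c * z) - c * (b' * y))
      = a' * (A * (b * x) - c * (a * y - c * z)) - c * (B * (a * z - c * y))" by (simp add: 1 3)
  have "a * (B * (a' * x - c * z)) - c * (A * (b' * y) - c * (a' * z - c * x))
      - (a' * (B * (a * x - c * y)) - c * (A * (b * z) - c * (a * y - c * x)))
      = c * y * (B * a' - (a * c + A * b')) + c * z * (a' * c + A * b - B * a)"
    by (simp add: algebra_simps)
  then show "a * (B * (a' * x - c * z)) - c * (A * (b' * y) - c * (a' * z - c * x))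
      = a' * (B * (a * x - c * y)) - c * (A * (b * z) - c * (a * y - c * x))" by (simp add: 2 3)
qed

text \<open>The sites run from \<open>s\<close> to \<open>N\<close>: \<open>s = 1\<close> gives the
  quantum space and \<open>s = 0\<close> the space extended by the auxiliary factor, so each
  operator identity is proved once for both.\<close>

locale spin_space =
  fixes N s D :: nat and \<eta> :: complex
  assumes dim: "D = 2 ^ (Suc N - s)"
begin

lemma less_dim_iff: "r < D \<longleftrightarrow> (\<forall>m. bit r m \<longrightarrow> m < Suc N - s)"
proof
  assume "r < D" then show "\<forall>m. bit r m \<longrightarrow> m < Suc N - s"
    using bit_nat_less[of r "Suc N - s"] by (simp add: dim)
next
  assume *: "\<forall>m. bit r m \<longrightarrow> m < Suc N - s"
  have "take_bit (Suc N - s) r = r"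
    by (rule bit_eqI) (use * in \<open>auto simp: bit_simps\<close>)
  then show "r < D" using take_bit_nat_less_exp[of "Suc N - s" r] by (simp add: dim)
qed

lemma put_spin_less: "\<lbrakk>r < D; n \<in> {s..N}\<rbrakk> \<Longrightarrow> put_spin N n p r < D"
  unfolding less_dim_iff by (auto simp: bit_put_spin)

lemma index_eqI:
  assumes "r < D" "c < D" "\<And>k. k \<in> {s..N} \<Longrightarrow> spin N k r = spin N k c"
  shows "r = c"
proof (rule bit_eqI)
  fix m
  show "bit r m \<longleftrightarrow> bit c m"
  proof (cases "m < Suc N - s")
    case True
    then have "N - m \<in> {s..N}" "N - (N - m) = m" by auto
    then show ?thesis using assms(3)[of "N - m"] by (simp add: spin_eq_bit of_bool_eq_iff)
  next
    case False
    then show ?thesis using assms(1,2) by (metis less_dim_iff)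
  qed
qed

lemma site_op_carrier [simp]: "site_op N D n A \<in> carrier_mat D D"
  and two_site_op_carrier [simp]: "two_site_op N D m n X \<in> carrier_mat D D"
  by (simp_all add: site_op_def two_site_op_def)

text \<open>In the row \<open>r\<close>, only columns that agree with \<open>r\<close> off the site
  \<open>n\<close> contribute. They are parametrised injectively by the new spin, which reduces a
  sum over the whole space to two terms.\<close>

lemma site_op_mult_index:
  assumes "n \<in> {s..N}" "B \<in> carrier_mat D e" "r < D" "c < e"
  shows "(site_op N D n A * B) $$ (r, c)
    = (\<Sum>p<2. A $$ (spin N n r, p) * B $$ (put_spin N n p r, c))"
proof -
  let ?C = "{x \<in> {0..<D}. \<forall>k\<in>{0..N} - {n}. spin N k r = spin N k x}"
  have C: "?C = (\<lambda>p. put_spin N n p r) ` {..<2}"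
  proof (intro equalityI subsetI)
    fix x assume x: "x \<in> ?C"
    have "x = put_spin N n (spin N n x) r"
    proof (rule index_eqI)
      fix k assume "k \<in> {s..N}"
      then show "spin N k x = spin N k (put_spin N n (spin N n x) r)"
        using x assms(1) by (cases "k = n") (auto simp: spin_put_spin_same spin_put_spin_other)
    qed (use x assms in \<open>auto simp: put_spin_less\<close>)
    then show "x \<in> (\<lambda>p. put_spin N n p r) ` {..<2}" by (rule image_eqI) simp
  qed (use assms in \<open>auto simp: put_spin_less spin_put_spin split: if_splits\<close>)
  have inj: "inj_on (\<lambda>p. put_spin N n p r) {..<2}"
    by (rule inj_on_inverseI[where g = "spin N n"]) (simp add: spin_put_spin_same)
  have "(site_op N D n A * B) $$ (r, c) = (\<Sum>x\<in>{0..<D}.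
      if \<forall>k\<in>{0..N} - {n}. spin N k r = spin N k x then A $$ (spin N n r, spin N n x) * B $$ (x, c) else 0)"
    using assms by (auto simp: site_op_def scalar_prod_def intro!: sum.cong)
  also have "\<dots> = (\<Sum>x\<in>?C. A $$ (spin N n r, spin N n x) * B $$ (x, c))"
    by (rule sum.inter_filter[symmetric]) simp
  also have "\<dots> = (\<Sum>p<2. A $$ (spin N n r, p) * B $$ (put_spin N n p r, c))"
    unfolding C by (subst sum.reindex[OF inj]) (auto simp: spin_put_spin_same intro!: sum.cong)
  finally show ?thesis .
qed

lemma two_site_op_mult_index:
  assumes "m \<in> {s..N}" "n \<in> {s..N}" "m \<noteq> n" "B \<in> carrier_mat D e" "r < D" "c < e"
  shows "(two_site_op N D m n X * B) $$ (r, c)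
    = (\<Sum>x\<in>{..<2} \<times> {..<2}. X $$ (2 * spin N m r + spin N n r, 2 * fst x + snd x)
        * B $$ (put_spin N m (fst x) (put_spin N n (snd x) r), c))"
proof -
  let ?C = "{x \<in> {0..<D}. \<forall>k\<in>{0..N} - {m, n}. spin N k r = spin N k x}"
  let ?f = "\<lambda>(p, q). put_spin N m p (put_spin N n q r)"
  have C: "?C = ?f ` ({..<2} \<times> {..<2})"
  proof (intro equalityI subsetI)
    fix x assume x: "x \<in> ?C"
    have "x = put_spin N m (spin N m x) (put_spin N n (spin N n x) r)"
    proof (rule index_eqI)
      fix k assume k: "k \<in> {s..N}"
      show "spin N k x = spin N k (put_spin N m (spin N m x) (put_spin N n (spin N n x) r))"
        using k x assms(1-3)
        by (cases "k = m"; cases "k = n") (auto simp: spin_put_spin_same spin_put_spin_other)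
    qed (use x assms in \<open>auto simp: put_spin_less\<close>)
    then show "x \<in> ?f ` ({..<2} \<times> {..<2})"
      by (intro image_eqI[where x = "(spin N m x, spin N n x)"]) auto
  qed (use assms in \<open>auto simp: put_spin_less spin_put_spin split: if_splits\<close>)
  have inj: "inj_on ?f ({..<2} \<times> {..<2})"
    using assms by (intro inj_on_inverseI[where g = "\<lambda>x. (spin N m x, spin N n x)"])
      (auto simp: spin_put_spin_same spin_put_spin_other)
  have "(two_site_op N D m n X * B) $$ (r, c) = (\<Sum>x\<in>{0..<D}.
      if \<forall>k\<in>{0..N} - {m, n}. spin N k r = spin N k x
      then X $$ (2 * spin N m r + spin N n r, 2 * spin N m x + spin N n x) * B $$ (x, c) else 0)"
    using assms by (auto simp: two_site_op_def scalar_prod_def intro!: sum.cong)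
  also have "\<dots> = (\<Sum>x\<in>?C. X $$ (2 * spin N m r + spin N n r, 2 * spin N m x + spin N n x) * B $$ (x, c))"
    by (rule sum.inter_filter[symmetric]) simp
  also have "\<dots> = (\<Sum>x\<in>{..<2} \<times> {..<2}. X $$ (2 * spin N m r + spin N n r, 2 * fst x + snd x)
        * B $$ (put_spin N m (fst x) (put_spin N n (snd x) r), c))"
    unfolding C using assms(1-3)
    by (subst sum.reindex[OF inj]) (auto simp: spin_put_spin_same spin_put_spin_other intro!: sum.cong)
  finally show ?thesis .
qed

section \<open>The R-matrix as an operator in two sites\<close>

abbreviation R :: "nat \<Rightarrow> nat \<Rightarrow> complex \<Rightarrow> complex mat" where
  "R m n l \<equiv> two_site_op N D m n (Rbar \<eta> l)"

lemma Rbar_index: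
  assumes "i < 4" "j < 4"
  shows "Rbar \<eta> l $$ (i, j) = (if i = j then if i = 0 \<or> i = 3 then sinh (l - \<eta>) else sinh l
    else if i + j = 3 \<and> i \<noteq> 0 \<and> j \<noteq> 0 then - sinh \<eta> else 0)"
proof -
  have "i \<in> {0, 1, 2, 3}" "j \<in> {0, 1, 2, 3}" using assms by auto
  then show ?thesis
    by (elim insertE emptyE) (simp_all add: Rbar_def mat_of_rows_list_def doubleton_eq_iff)
qed

text \<open>The R-matrix conserves the total spin of the two sites: parallel spins give a scalar,
  antiparallel ones a combination of the identity and the swap. All case analyses below rest on this
  rule.\<close>

lemma R_mult_index:
  assumes "m \<in> {s..N}" "n \<in> {s..N}" "m \<noteq> n" "B \<in> carrier_mat D e" "r < D" "c < e"
  shows "(R m n l * B) $$ (r, c) = (if spin N m r = spin N n r then sinh (l - \<eta>) * B $$ (r, c)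
    else sinh l * B $$ (r, c)
      - sinh \<eta> * B $$ (put_spin N m (spin N n r) (put_spin N n (spin N m r) r), c))"
proof -
  have "{..<2} \<times> {..<2} = {(0, 0), (0, 1), (1, 0), (1 :: nat, 1 :: nat)}"
    by (auto simp: less_2_cases_iff)
  then have sum2: "(\<Sum>x\<in>{..<2} \<times> {..<2}. f x) = f (0, 0) + f (0, 1) + f (1, 0) + f (1, 1)"
    for f :: "nat \<times> nat \<Rightarrow> complex" by simp
  have triv: "put_spin N m (spin N m r) r = r" "put_spin N n (spin N n r) r = r"
    by (simp_all add: put_spin_trivial)
  consider (00) "spin N m r = 0" "spin N n r = 0" | (01) "spin N m r = 0" "spin N n r = 1"
    | (10) "spin N m r = 1" "spin N n r = 0" | (11) "spin N m r = 1" "spin N n r = 1"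
    using spin_cases[of N m r] spin_cases[of N n r] by (elim disjE) auto
  then show ?thesis
    by cases (use triv in \<open>simp_all add: two_site_op_mult_index[OF assms] sum2 Rbar_index\<close>)
qed


text \<open>Testing against a general \<open>B\<close> keeps the entries of the right factor atomic in the case analyses below.\<close>

lemma op_eqI:
  fixes A A' :: "complex mat"
  assumes "A \<in> carrier_mat D D" "A' \<in> carrier_mat D D"
    and "\<And>B r c. \<lbrakk>B \<in> carrier_mat D D; r < D; c < D\<rbrakk> \<Longrightarrow> (A * B) $$ (r, c) = (A' * B) $$ (r, c)"
  shows "A = A'"
proof (rule eq_matI)
  fix i j assume "i < dim_row A'" "j < dim_col A'"
  then show "A $$ (i, j) = A' $$ (i, j)"
    using assms(3)[of "1\<^sub>m D" i j] assms(1,2) by (simp del: index_mult_mat)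
qed (use assms in auto)

lemmas op_index_simps = R_mult_index[where e = D] site_op_mult_index[where e = D]
  put_spin_less spin_put_spin put_spin_put_spin put_spin_trivial

lemma mult_carrier_D [simp]: "\<lbrakk>A \<in> carrier_mat D D; B \<in> carrier_mat D D\<rbrakk>
  \<Longrightarrow> A * B \<in> carrier_mat D D"
  by (rule mult_carrier_mat)

lemma mult_assoc_D [simp]: "\<lbrakk>A \<in> carrier_mat D D; B \<in> carrier_mat D D; C \<in> carrier_mat D D\<rbrakk>
  \<Longrightarrow> A * B * C = A * (B * C)"
  by (rule assoc_mult_mat)

lemma R_unitarity:
  assumes "m \<in> {s..N}" "n \<in> {s..N}" "m \<noteq> n"
  shows "R m n l * R n m (- l) = (sinh (l - \<eta>) * sinh (- l - \<eta>)) \<cdot>\<^sub>m 1\<^sub>m D"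
proof (rule op_eqI)
  fix B :: "complex mat" and r c assume rc: "B \<in> carrier_mat D D" "r < D" "c < D"
  \<comment> \<open>On antiparallel spins the swap terms cancel and the right-hand side remains;
    this identifies it with the scalar found on parallel spins.\<close>
  have h: "sinh (l - \<eta>) * (sinh (- l - \<eta>) * x) = sinh \<eta> * (sinh \<eta> * x) - sinh l * (sinh l * x)" for x
    by (simp add: mult.assoc[symmetric] sinh_products(4) left_diff_distrib)
  have "((sinh (l - \<eta>) * sinh (- l - \<eta>)) \<cdot>\<^sub>m 1\<^sub>m D * B) $$ (r, c)
      = (sinh (l - \<eta>) * sinh (- l - \<eta>)) * B $$ (r, c)"
    using rc by (simp add: mult_smult_assoc_mat[of _ D D _ D] del: index_mult_mat)
  moreover have "(R m n l * (R n m (- l) * B)) $$ (r, c)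
      = (sinh (l - \<eta>) * sinh (- l - \<eta>)) * B $$ (r, c)"
    using assms rc spin_cases[of N m r] spin_cases[of N n r]
    by (elim disjE) (simp_all add: op_index_simps put_spin_commute[of m N n] h mult.assoc
       right_diff_distrib del: index_mult_mat)
  ultimately show "(R m n l * R n m (- l) * B) $$ (r, c)
      = ((sinh (l - \<eta>) * sinh (- l - \<eta>)) \<cdot>\<^sub>m 1\<^sub>m D * B) $$ (r, c)"
    using rc by simp
qed simp_all

lemma two_site_op_disjoint_commute:
  assumes "{j, k, m, n} \<subseteq> {s..N}" "j \<noteq> k" "m \<noteq> n" "{j, k} \<inter> {m, n} = {}"
  shows "two_site_op N D j k X * two_site_op N D m n Y = two_site_op N D m n Y * two_site_op N D j k X"
proof (rule op_eqI)
  fix B :: "complex mat" and r c assume rc: "B \<in> carrier_mat D D" "r < D" "c < D"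
  let ?P = "{..<2} \<times> {..<2 :: nat}"
  \<comment> \<open>Since the pairs are disjoint, changing the spins of one pair leaves the matrix
    indices of the other unchanged, and the two orders differ only in the order of
    summation.\<close>
  have expand: "(two_site_op N D j k X * (two_site_op N D m n Y * B)) $$ (r, c)
    = (\<Sum>x\<in>?P. \<Sum>y\<in>?P. X $$ (2 * spin N j r + spin N k r, 2 * fst x + snd x)
        * Y $$ (2 * spin N m r + spin N n r, 2 * fst y + snd y)
        * B $$ (put_spin N m (fst y) (put_spin N n (snd y)
            (put_spin N j (fst x) (put_spin N k (snd x) r))), c))"
    if "{j, k, m, n} \<subseteq> {s..N}" "j \<noteq> k" "m \<noteq> n" "{j, k} \<inter> {m, n} = {}" for j k m n X Y
    using that rc
    by (auto simp: two_site_op_mult_index[where e = D] put_spin_less spin_put_spin sum_distrib_left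
      mult.assoc simp del: index_mult_mat intro!: sum.cong)
  have "put_spin N j p (put_spin N k q (put_spin N m p' (put_spin N n q' r)))
    = put_spin N m p' (put_spin N n q' (put_spin N j p (put_spin N k q r)))" for p q p' q'
    using assms by (simp add: put_spin_commute[of j N m] put_spin_commute[of j N n]
      put_spin_commute[of k N m] put_spin_commute[of k N n])
  then show "(two_site_op N D j k X * two_site_op N D m n Y * B) $$ (r, c)
      = (two_site_op N D m n Y * two_site_op N D j k X * B) $$ (r, c)"
    using rc expand[of j k m n X Y] trans[OF expand[of m n j k Y X] sum.swap] assms
    by (simp add: Int_commute mult.commute del: index_mult_mat)
qed simp_all

lemma site_op_disjoint_commute:
  assumes "{m, n, k} \<subseteq> {s..N}" "distinct [m, n, k]"
  shows "site_op N D k A * two_site_op N D m n X = two_site_op N D m n X * site_op N D k A"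
proof (rule op_eqI)
  fix B :: "complex mat" and r c assume rc: "B \<in> carrier_mat D D" "r < D" "c < D"
  let ?P = "{..<2} \<times> {..<2 :: nat}"
  have 1: "(site_op N D k A * (two_site_op N D m n X * B)) $$ (r, c)
    = (\<Sum>p<2. \<Sum>y\<in>?P. A $$ (spin N k r, p) * X $$ (2 * spin N m r + spin N n r, 2 * fst y + snd y)
        * B $$ (put_spin N m (fst y) (put_spin N n (snd y) (put_spin N k p r)), c))"
    using assms rc
    by (auto simp: two_site_op_mult_index[where e = D] site_op_mult_index[where e = D] put_spin_less
      spin_put_spin sum_distrib_left mult.assoc
      simp del: index_mult_mat intro!: sum.cong)
  have 2: "(two_site_op N D m n X * (site_op N D k A * B)) $$ (r, c)
    = (\<Sum>y\<in>?P. \<Sum>p<2. X $$ (2 * spin N m r + spin N n r, 2 * fst y + snd y) * A $$ (spin N k r, p)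
        * B $$ (put_spin N k p (put_spin N m (fst y) (put_spin N n (snd y) r)), c))"
    using assms rc
    by (auto simp: two_site_op_mult_index[where e = D] site_op_mult_index[where e = D] put_spin_less
      spin_put_spin sum_distrib_left mult.assoc
      simp del: index_mult_mat intro!: sum.cong)
  have "put_spin N k p (put_spin N m p' (put_spin N n q' r))
    = put_spin N m p' (put_spin N n q' (put_spin N k p r))" for p p' q'
    using assms by (simp add: put_spin_commute[of k N m] put_spin_commute[of k N n])
  then show "(site_op N D k A * two_site_op N D m n X * B) $$ (r, c)
      = (two_site_op N D m n X * site_op N D k A * B) $$ (r, c)"
    using rc 1 trans[OF 2 sum.swap] by (simp add: mult.commute del: index_mult_mat)
qed simp_all

text \<open>The equation is checked for each of the eight configurations of the three spins; those
  not all equal reduce to \<open>yang_baxter_elements\<close>.\<close>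

lemma R_yang_baxter:
  assumes "{j, k, n} \<subseteq> {s..N}" "distinct [n, j, k]"
  shows "R n j l * R n k (l + l') * R j k l' = R j k l' * R n k (l + l') * R n j l"
proof (rule op_eqI)
  fix B :: "complex mat" and r c assume rc: "B \<in> carrier_mat D D" "r < D" "c < D"
  show "(R n j l * R n k (l + l') * R j k l' * B) $$ (r, c)
    = (R j k l' * R n k (l + l') * R n j l * B) $$ (r, c)"
    using assms rc spin_cases[of N j r] spin_cases[of N k r] spin_cases[of N n r]
    by (elim disjE) (simp add: op_index_simps put_spin_commute del: index_mult_mat;
      rule yang_baxter_elements)+
qed (use assms in \<open>simp_all\<close>)

text \<open>The rule for the entries is invariant under exchange of the two sites. Crossing produces
  \<open>R n k\<close> at \<open>\<xi> k - \<xi> n\<close>, which this turns into a multiple of the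
  inverse of the normalised \<open>r n k\<close>.\<close>

lemma R_symmetric:
  assumes "m \<in> {s..N}" "n \<in> {s..N}" "m \<noteq> n"
  shows "R m n l = R n m l"
proof (rule op_eqI)
  fix B :: "complex mat" and r c assume rc: "B \<in> carrier_mat D D" "r < D" "c < D"
  show "(R m n l * B) $$ (r, c) = (R n m l * B) $$ (r, c)"
    using assms rc by (simp add: R_mult_index[where e = D] put_spin_commute[of m N n] del: index_mult_mat)
qed simp_all

text \<open>At the point \<open>0\<close> the R-matrix is a multiple of the permutation operator, so it relabels sites.\<close>

lemma R_0_mult_index:
  assumes "m \<in> {s..N}" "n \<in> {s..N}" "m \<noteq> n" "B \<in> carrier_mat D e" "r < D" "c < e"
  shows "(R m n 0 * B) $$ (r, c)
    = - sinh \<eta> * B $$ (put_spin N m (spin N n r) (put_spin N n (spin N m r) r), c)"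
  using assms(1-3) by (auto simp: R_mult_index[OF assms] put_spin_trivial)

lemma R_exchange:
  assumes "{m, n, k} \<subseteq> {s..N}" "distinct [m, n, k]"
  shows "R m k l * R m n 0 = R m n 0 * R n k l" "R m n 0 * R m k l = R n k l * R m n 0"
proof -
  show "R m k l * R m n 0 = R m n 0 * R n k l"
  proof (rule op_eqI)
    fix B :: "complex mat" and r c assume rc: "B \<in> carrier_mat D D" "r < D" "c < D"
    show "(R m k l * R m n 0 * B) $$ (r, c) = (R m n 0 * R n k l * B) $$ (r, c)"
      using assms rc spin_cases[of N m r] spin_cases[of N n r] spin_cases[of N k r]
      by (elim disjE) (simp_all add: R_0_mult_index[where e = D] op_index_simps put_spin_commute
        algebra_simps del: index_mult_mat)
  qed simp_all
  show "R m n 0 * R m k l = R n k l * R m n 0"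
  proof (rule op_eqI)
    fix B :: "complex mat" and r c assume rc: "B \<in> carrier_mat D D" "r < D" "c < D"
    show "(R m n 0 * R m k l * B) $$ (r, c) = (R n k l * R m n 0 * B) $$ (r, c)"
      using assms rc spin_cases[of N m r] spin_cases[of N n r] spin_cases[of N k r]
      by (elim disjE) (simp_all add: R_0_mult_index[where e = D] op_index_simps put_spin_commute
        algebra_simps del: index_mult_mat)
  qed simp_all
qed

lemma site_op_mult:
  assumes "n \<in> {s..N}" "A \<in> carrier_mat 2 2" "A' \<in> carrier_mat 2 2"
  shows "site_op N D n A * site_op N D n A' = site_op N D n (A * A')"
proof (rule op_eqI)
  fix B :: "complex mat" and r c assume rc: "B \<in> carrier_mat D D" "r < D" "c < D"
  have sum2: "(\<Sum>p<2. f p) = f 0 + f 1" "sum f {0..<2} = f 0 + f 1" for f :: "nat \<Rightarrow> complex"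
    by (simp_all add: numeral_2_eq_2)
  have *: "(A * A') $$ (p, q) = A $$ (p, 0) * A' $$ (0, q) + A $$ (p, 1) * A' $$ (1, q)"
    if "p < 2" "q < 2" for p q
    using that assms by (simp add: scalar_prod_def sum2)
  show "(site_op N D n A * site_op N D n A' * B) $$ (r, c) = (site_op N D n (A * A') * B) $$ (r, c)"
    using assms(1) rc by (simp add: sum2 site_op_mult_index[where e = D] put_spin_less spin_put_spin
      put_spin_put_spin * algebra_simps del: index_mult_mat)
qed simp_all

end


section \<open>The auxiliary space\<close>

lemma spin_aux:
  assumes "r < 2 ^ N" "a < 2" "k \<le> N"
  shows "spin N k (a * 2 ^ N + r) = (if k = 0 then a else spin N k r)" "spin N 0 r = 0"
proof -
  show "spin N 0 r = 0" using assms by (simp add: spin_def)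
  have "(a * 2 ^ N + r) div 2 ^ (N - k) = a * 2 ^ k + r div 2 ^ (N - k)"
  proof -
    have e: "a * 2 ^ N = 2 ^ (N - k) * (a * 2 ^ k)"
      using assms(3) by (simp flip: power_add)
    show ?thesis unfolding e by (rule div_mult_self4) simp
  qed
  then show "spin N k (a * 2 ^ N + r) = (if k = 0 then a else spin N k r)"
    using assms by (cases k) (simp_all add: spin_def mult.left_commute[of a 2])
qed

lemma mat_prod_simps [simp]:
  "mat_prod D [] = 1\<^sub>m D" "mat_prod D (A # As) = A * mat_prod D As"
  by (simp_all add: mat_prod_def)

lemma mat_prod_carrier: "set As \<subseteq> carrier_mat D D \<Longrightarrow> mat_prod D As \<in> carrier_mat D D"
  by (induction As) auto

lemma mat_prod_append:
  assumes "set As \<subseteq> carrier_mat D D" "set Bs \<subseteq> carrier_mat D D"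
  shows "mat_prod D (As @ Bs) = mat_prod D As * mat_prod D Bs"
  using assms by (induction As) (auto simp: mat_prod_carrier assoc_mult_mat[of _ D D _ D _ D]
      left_mult_one_mat[OF mat_prod_carrier])

lemma mat_prod_intertwine:
  assumes "P \<in> carrier_mat D D" "\<And>k. k \<in> set ks \<Longrightarrow> f k \<in> carrier_mat D D"
    "\<And>k. k \<in> set ks \<Longrightarrow> g k \<in> carrier_mat D D" "\<And>k. k \<in> set ks \<Longrightarrow> P * f k = g k * P"
  shows "P * mat_prod D (map f ks) = mat_prod D (map g ks) * P"
  using assms(2-4)
proof (induction ks)
  case (Cons k ks)
  have c: "f k \<in> carrier_mat D D" "g k \<in> carrier_mat D D"
    "mat_prod D (map f ks) \<in> carrier_mat D D" "mat_prod D (map g ks) \<in> carrier_mat D D"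
    using Cons.prems by (auto intro!: mat_prod_carrier)
  note assoc = assoc_mult_mat[of _ D D _ D _ D]
  have "P * mat_prod D (map f (k # ks)) = P * f k * mat_prod D (map f ks)"
    using c assms(1) by (simp add: assoc)
  also have "\<dots> = g k * (P * mat_prod D (map f ks))"
    using c assms(1) Cons.prems by (simp add: assoc)
  also have "\<dots> = mat_prod D (map g (k # ks)) * P"
    using c assms(1) Cons by (simp add: assoc)
  finally show ?case .
qed (use assms(1) in simp)

locale auxiliary_space =
  fixes N D E :: nat and \<eta> :: complex
  assumes D_def: "D = 2 ^ N" and E_def: "E = 2 ^ (N + 1)"
begin

sublocale H: spin_space N 1 D \<eta> by unfold_locales (simp add: D_def)
sublocale X: spin_space N 0 E \<eta> by unfold_locales (simp add: E_def)

lemma E_eq: "E = D + D" by (simp add: D_def E_def)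

section \<open>Auxiliary entries as blocks of a matrix\<close>

lemma aux_entry_carrier [simp]: "aux_entry N A j i \<in> carrier_mat D D"
  by (simp add: aux_entry_def D_def)

lemma aux_entry_dim [simp]: "dim_row (aux_entry N A j i) = D" "dim_col (aux_entry N A j i) = D"
  by (simp_all add: aux_entry_def D_def)

lemma aux_entry_index:
  "r < D \<Longrightarrow> c < D \<Longrightarrow> aux_entry N A j i $$ (r, c) = A $$ ((j - 1) * D + r, (i - 1) * D + c)"
  by (simp add: aux_entry_def D_def)

lemma aux_less: "r < D \<Longrightarrow> j \<in> {1, 2} \<Longrightarrow> (j - 1) * D + r < E"
  by (auto simp: E_eq)

text \<open>Multiplication of block matrices: the sum over the indices of the extended space is
  split at \<open>D\<close>, that is, by the auxiliary spin.\<close>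

lemma aux_entry_mult:
  assumes "A \<in> carrier_mat E E" "B \<in> carrier_mat E E" "j \<in> {1, 2}" "i \<in> {1, 2}"
  shows "aux_entry N (A * B) j i = aux_entry N A j 1 * aux_entry N B 1 i + aux_entry N A j 2 * aux_entry N B 2 i"
proof (rule eq_matI)
  fix r c
  assume "r < dim_row (aux_entry N A j 1 * aux_entry N B 1 i + aux_entry N A j 2 * aux_entry N B 2 i)"
    "c < dim_col (aux_entry N A j 1 * aux_entry N B 1 i + aux_entry N A j 2 * aux_entry N B 2 i)"
  then have rc: "r < D" "c < D" by auto
  let ?r = "(j - 1) * D + r" and ?c = "(i - 1) * D + c"
  have "aux_entry N (A * B) j i $$ (r, c) = (\<Sum>k\<in>{0..<E}. A $$ (?r, k) * B $$ (k, ?c))"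
    using assms rc aux_less[of r j] aux_less[of c i] by (simp add: aux_entry_index scalar_prod_def)
  also have "\<dots> = (\<Sum>k\<in>{0..<D}. A $$ (?r, k) * B $$ (k, ?c)) + (\<Sum>k\<in>{D..<D + D}. A $$ (?r, k) * B $$ (k, ?c))"
    unfolding E_eq by (rule sum.atLeastLessThan_concat[symmetric]) auto
  also have "(\<Sum>k\<in>{D..<D + D}. A $$ (?r, k) * B $$ (k, ?c)) = (\<Sum>k\<in>{0..<D}. A $$ (?r, D + k) * B $$ (D + k, ?c))"
    using sum.shift_bounds_nat_ivl[of "\<lambda>k. A $$ (?r, k) * B $$ (k, ?c)" 0 D D] by (simp add: add.commute)
  also have "(\<Sum>k\<in>{0..<D}. A $$ (?r, k) * B $$ (k, ?c)) + \<dots>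
      = (aux_entry N A j 1 * aux_entry N B 1 i + aux_entry N A j 2 * aux_entry N B 2 i) $$ (r, c)"
    using rc by (simp add: scalar_prod_def aux_entry_index)
  finally show "aux_entry N (A * B) j i $$ (r, c)
    = (aux_entry N A j 1 * aux_entry N B 1 i + aux_entry N A j 2 * aux_entry N B 2 i) $$ (r, c)" .
qed auto

lemma aux_eqI:
  assumes "A \<in> carrier_mat E E" "B \<in> carrier_mat E E"
    and "\<And>j i. \<lbrakk>j \<in> {1, 2}; i \<in> {1, 2}\<rbrakk> \<Longrightarrow> aux_entry N A j i = aux_entry N B j i"
  shows "A = B"
proof (rule eq_matI)
  fix r c assume "r < dim_row B" "c < dim_col B"
  then have rc: "r < D + D" "c < D + D" using assms(2) by (auto simp: E_eq)
  have "\<exists>j\<in>{1, 2}. \<exists>k<D. x = (j - 1) * D + k" if "x < D + D" for x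
  proof (cases "x < D")
    case False
    then show ?thesis using that by (intro bexI[of _ 2] exI[of _ "x - D"]) auto
  qed auto
  then obtain j k i l where "j \<in> {1, 2}" "k < D" "r = (j - 1) * D + k"
    "i \<in> {1, 2}" "l < D" "c = (i - 1) * D + l"
    using rc by meson
  then show "A $$ (r, c) = B $$ (r, c)"
    using assms(3)[of j i] aux_entry_index by metis
qed (use assms in auto)

lemma spin_aux_index:
  assumes "r < D" "j \<in> {1, 2}" "k \<le> N"
  shows "spin N k ((j - 1) * D + r) = (if k = 0 then j - 1 else spin N k r)" "spin N 0 r = 0"
  using spin_aux[of r N "j - 1" k] assms by (auto simp: D_def)

text \<open>The auxiliary digit of an index is its block number and the other digits are those of
  the index within the block, so comparisons decouple. Within a block the digit of the site 0 is
  always 0.\<close>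

lemma spins_agree:
  assumes "r < D" "c < D" "j \<in> {1, 2}" "i \<in> {1, 2}"
  shows "(\<forall>k\<in>{0..N} - S. spin N k ((j - 1) * D + r) = spin N k ((i - 1) * D + c))
      \<longleftrightarrow> (0 \<in> S \<or> j = i) \<and> (\<forall>k\<in>{0..N} - S. spin N k r = spin N k c)" (is ?A)
    and "(\<forall>k\<in>{0..N} - insert 0 S. spin N k r = spin N k c) \<longleftrightarrow> (\<forall>k\<in>{0..N} - S. spin N k r = spin N k c)"
      (is ?B)
proof -
  have 0: "spin N 0 r = 0" "spin N 0 c = 0"
    using assms spin_aux_index(2)[of r j 0] spin_aux_index(2)[of c i 0] by auto
  show ?B using 0 by (metis Diff_iff insert_iff)
  have "j - 1 = i - 1 \<longleftrightarrow> j = i" using assms(3,4) by auto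
  then have *: "spin N k ((j - 1) * D + r) = spin N k ((i - 1) * D + c)
    \<longleftrightarrow> (if k = 0 then j = i else spin N k r = spin N k c)" if "k \<le> N" for k
    using spin_aux_index(1)[OF assms(1,3) that] spin_aux_index(1)[OF assms(2,4) that] by (metis (full_types))
  show ?A
  proof
    assume L: "\<forall>k\<in>{0..N} - S. spin N k ((j - 1) * D + r) = spin N k ((i - 1) * D + c)"
    have "spin N k r = spin N k c" if "k \<in> {0..N} - S" for k
      using L *[of k] that 0 by (cases "k = 0") auto
    moreover have "0 \<in> S \<or> j = i" using L *[of 0] by auto
    ultimately show "(0 \<in> S \<or> j = i) \<and> (\<forall>k\<in>{0..N} - S. spin N k r = spin N k c)" by blast
  next
    assume R: "(0 \<in> S \<or> j = i) \<and> (\<forall>k\<in>{0..N} - S. spin N k r = spin N k c)"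
    show "\<forall>k\<in>{0..N} - S. spin N k ((j - 1) * D + r) = spin N k ((i - 1) * D + c)"
    proof
      fix k assume k: "k \<in> {0..N} - S"
      then show "spin N k ((j - 1) * D + r) = spin N k ((i - 1) * D + c)"
        using R *[of k] by (cases "k = 0") auto
    qed
  qed
qed

lemma aux_entry_mat:
  assumes "r < D" "c < D" "j \<in> {1, 2}" "i \<in> {1, 2}"
  shows "aux_entry N (mat E E f) j i $$ (r, c) = f ((j - 1) * D + r, (i - 1) * D + c)"
  using assms(1,2) aux_less[OF assms(1,3)] aux_less[OF assms(2,4)] by (simp add: aux_entry_index)

lemma aux_entry_eqI:
  assumes "B \<in> carrier_mat D D"
    "\<And>r c. r < D \<Longrightarrow> c < D \<Longrightarrow> aux_entry N A j i $$ (r, c) = B $$ (r, c)"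
  shows "aux_entry N A j i = B"
  by (rule eq_matI) (use assms in auto)

lemma aux_entry_two_site_op:
  assumes "m \<in> {1..N}" "n \<in> {1..N}" "j \<in> {1, 2}" "i \<in> {1, 2}"
  shows "aux_entry N (two_site_op N E m n X) j i = (if j = i then two_site_op N D m n X else 0\<^sub>m D D)"
proof (rule aux_entry_eqI)
  fix r c assume rc: "r < D" "c < D"
  have [simp]: "m \<noteq> 0" "n \<noteq> 0" "0 \<noteq> m" "0 \<noteq> n" using assms by auto
  have 1: "spin N m ((j - 1) * D + r) = spin N m r" "spin N n ((j - 1) * D + r) = spin N n r"
    "spin N m ((i - 1) * D + c) = spin N m c" "spin N n ((i - 1) * D + c) = spin N n c"
    using spin_aux_index(1) rc assms by (simp_all del: One_nat_def)
  have "aux_entry N (two_site_op N E m n X) j i $$ (r, c) = (if j = i \<and> (\<forall>k\<in>{0..N} - {m, n}. spin N k r = spin N k c)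
     then X $$ (2 * spin N m r + spin N n r, 2 * spin N m c + spin N n c) else 0)"
    unfolding two_site_op_def aux_entry_mat[OF rc assms(3,4)]
    by (simp only: prod.case spins_agree(1)[OF rc assms(3,4)] 1) simp
  then show "aux_entry N (two_site_op N E m n X) j i $$ (r, c)
      = (if j = i then two_site_op N D m n X else 0\<^sub>m D D) $$ (r, c)"
    using rc by (simp add: two_site_op_def)
qed (auto simp: two_site_op_def)

lemma aux_entry_site_op:
  assumes "n \<in> {1..N}" "j \<in> {1, 2}" "i \<in> {1, 2}"
  shows "aux_entry N (site_op N E n A) j i = (if j = i then site_op N D n A else 0\<^sub>m D D)"
proof (rule aux_entry_eqI)
  fix r c assume rc: "r < D" "c < D"
  have [simp]: "n \<noteq> 0" "0 \<noteq> n" using assms by auto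
  have 1: "spin N n ((j - 1) * D + r) = spin N n r" "spin N n ((i - 1) * D + c) = spin N n c"
    using spin_aux_index(1) rc assms by (simp_all del: One_nat_def)
  have "aux_entry N (site_op N E n A) j i $$ (r, c) = (if j = i \<and> (\<forall>k\<in>{0..N} - {n}. spin N k r = spin N k c)
     then A $$ (spin N n r, spin N n c) else 0)"
    unfolding site_op_def aux_entry_mat[OF rc assms(2,3)]
    by (simp only: prod.case spins_agree(1)[OF rc assms(2,3)] 1) simp
  then show "aux_entry N (site_op N E n A) j i $$ (r, c)
      = (if j = i then site_op N D n A else 0\<^sub>m D D) $$ (r, c)"
    using rc by (simp add: site_op_def)
qed (auto simp: site_op_def)

lemma aux_entry_two_site_op_0:
  assumes "n \<in> {1..N}" "j \<in> {1, 2}" "i \<in> {1, 2}"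
  shows "aux_entry N (two_site_op N E 0 n X) j i
    = site_op N D n (mat 2 2 (\<lambda>(p, q). X $$ (2 * (j - 1) + p, 2 * (i - 1) + q)))"
proof (rule aux_entry_eqI)
  fix r c assume rc: "r < D" "c < D"
  have 1: "spin N n ((j - 1) * D + r) = spin N n r" "spin N n ((i - 1) * D + c) = spin N n c"
    "spin N 0 ((j - 1) * D + r) = j - 1" "spin N 0 ((i - 1) * D + c) = i - 1"
    using spin_aux_index(1) rc assms by (simp_all del: One_nat_def)
  have "aux_entry N (two_site_op N E 0 n X) j i $$ (r, c) = (if \<forall>k\<in>{0..N} - {n}. spin N k r = spin N k c
     then X $$ (2 * (j - 1) + spin N n r, 2 * (i - 1) + spin N n c) else 0)"
    unfolding two_site_op_def aux_entry_mat[OF rc assms(2,3)]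
    by (simp only: prod.case spins_agree[OF rc assms(2,3)] 1) simp
  then show "aux_entry N (two_site_op N E 0 n X) j i $$ (r, c)
      = site_op N D n (mat 2 2 (\<lambda>(p, q). X $$ (2 * (j - 1) + p, 2 * (i - 1) + q))) $$ (r, c)"
    using rc by (simp add: site_op_def)
qed (auto simp: site_op_def)

lemma aux_entry_site_op_0:
  assumes "j \<in> {1, 2}" "i \<in> {1, 2}"
  shows "aux_entry N (site_op N E 0 A) j i = A $$ (j - 1, i - 1) \<cdot>\<^sub>m 1\<^sub>m D"
proof (rule aux_entry_eqI)
  fix r c assume rc: "r < D" "c < D"
  have 1: "spin N 0 ((j - 1) * D + r) = j - 1" "spin N 0 ((i - 1) * D + c) = i - 1"
    using spin_aux_index(1)[of _ _ 0] rc assms by (simp_all del: One_nat_def)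
  \<comment> \<open>Agreement of all quantum spins forces equal indices, so each block is a multiple
    of the identity.\<close>
  have "(\<forall>k\<in>{0..N} - {0}. spin N k r = spin N k c) \<longleftrightarrow> r = c"
    using H.index_eqI[OF rc] by auto
  then have "aux_entry N (site_op N E 0 A) j i $$ (r, c) = (if r = c then A $$ (j - 1, i - 1) else 0)"
    unfolding site_op_def aux_entry_mat[OF rc assms]
    by (simp only: prod.case spins_agree(1)[OF rc assms] 1) simp
  then show "aux_entry N (site_op N E 0 A) j i $$ (r, c) = (A $$ (j - 1, i - 1) \<cdot>\<^sub>m 1\<^sub>m D) $$ (r, c)"
    using rc by simp
qed simp

section \<open>Operators that act trivially on the auxiliary space\<close>

definition extends :: "complex mat \<Rightarrow> complex mat \<Rightarrow> bool" where
  "extends Y Z \<longleftrightarrow> Y \<in> carrier_mat E E \<and> Z \<in> carrier_mat D D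
    \<and> (\<forall>j\<in>{1, 2}. \<forall>i\<in>{1, 2}. aux_entry N Y j i = (if j = i then Z else 0\<^sub>m D D))"

lemma extendsD:
  assumes "extends Y Z"
  shows "Y \<in> carrier_mat E E" "Z \<in> carrier_mat D D"
    "j \<in> {1, 2} \<Longrightarrow> i \<in> {1, 2} \<Longrightarrow> aux_entry N Y j i = (if j = i then Z else 0\<^sub>m D D)"
  using assms unfolding extends_def by blast+

lemma aux_entry_extends_mult:
  assumes "extends Y Z" "A \<in> carrier_mat E E" "j \<in> {1, 2}" "i \<in> {1, 2}"
  shows "aux_entry N (Y * A) j i = Z * aux_entry N A j i" "aux_entry N (A * Y) j i = aux_entry N A j i * Z"
  using assms extendsD[OF assms(1)]
  by (auto simp: aux_entry_mult left_mult_zero_mat[of _ D D] right_mult_zero_mat[of _ D D]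
      left_add_zero_mat[of _ D D] right_add_zero_mat[of _ D D])

lemma extends_mult:
  assumes "extends Y Z" "extends Y' Z'"
  shows "extends (Y * Y') (Z * Z')"
  unfolding extends_def using assms extendsD[OF assms(1)] extendsD[OF assms(2)]
  by (auto simp: aux_entry_extends_mult[OF assms(1)] right_mult_zero_mat[of _ D D])

lemma extends_one: "extends (1\<^sub>m E) (1\<^sub>m D)"
  unfolding extends_def by (auto simp: aux_entry_index E_eq intro!: eq_matI)

lemma extends_mat_prod:
  assumes "\<And>k. k \<in> set ks \<Longrightarrow> extends (f k) (g k)"
  shows "extends (mat_prod E (map f ks)) (mat_prod D (map g ks))"
  using assms by (induction ks) (auto intro: extends_one extends_mult)

lemma extends_R: "\<lbrakk>m \<in> {1..N}; n \<in> {1..N}\<rbrakk> \<Longrightarrow> extends (X.R m n l) (H.R m n l)"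
  and extends_site_op: "n \<in> {1..N} \<Longrightarrow> extends (site_op N E n A) (site_op N D n A)"
  by (simp_all add: extends_def aux_entry_two_site_op aux_entry_site_op)

lemma aux_entry_site_op_0_mult:
  assumes "M \<in> carrier_mat E E" "j \<in> {1, 2}" "i \<in> {1, 2}"
  shows "aux_entry N (site_op N E 0 A * M) j i
      = A $$ (j - 1, 0) \<cdot>\<^sub>m aux_entry N M 1 i + A $$ (j - 1, 1) \<cdot>\<^sub>m aux_entry N M 2 i" (is ?L)
    and "aux_entry N (M * site_op N E 0 A) j i
      = A $$ (0, i - 1) \<cdot>\<^sub>m aux_entry N M j 1 + A $$ (1, i - 1) \<cdot>\<^sub>m aux_entry N M j 2" (is ?R)
proof -
  have "x \<cdot>\<^sub>m 1\<^sub>m D * Y = x \<cdot>\<^sub>m Y" "Y * (x \<cdot>\<^sub>m 1\<^sub>m D) = x \<cdot>\<^sub>m Y" if "Y \<in> carrier_mat D D"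
    for Y :: "complex mat" and x
    using that by (simp_all add: mult_smult_assoc_mat[of _ D D _ D] mult_smult_distrib[of _ D D _ D])
  then show ?L ?R
    using assms by (simp_all add: aux_entry_mult aux_entry_site_op_0)
qed

text \<open>The block \<open>(a, b)\<close> of the permutation is the elementary matrix with indices
  \<open>b\<close>, \<open>a\<close> at the site \<open>n\<close>. Summing it against
  \<open>A\<close> and \<open>B\<close> gives \<open>B * elem_mat i j * A\<close>; this is why the
  entry \<open>j i\<close> of the monodromy matrix reconstructs \<open>elem_mat i j\<close>.\<close>

lemma aux_entry_permutation:
  assumes "n \<in> {1..N}" "A \<in> carrier_mat 2 2" "B \<in> carrier_mat 2 2" "j \<in> {1, 2}" "i \<in> {1, 2}"
  shows "aux_entry N (site_op N E 0 A * X.R 0 n 0 * site_op N E 0 B) j i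
    = (- sinh \<eta>) \<cdot>\<^sub>m site_op N D n (B * elem_mat i j * A)"
proof (rule eq_matI)
  fix r c assume "r < dim_row ((- sinh \<eta>) \<cdot>\<^sub>m site_op N D n (B * elem_mat i j * A))"
    "c < dim_col ((- sinh \<eta>) \<cdot>\<^sub>m site_op N D n (B * elem_mat i j * A))"
  then have rc: "r < D" "c < D" by (auto simp: site_op_def)
  have sum2: "sum f {0..<2} = f 0 + f 1" for f :: "nat \<Rightarrow> complex"
    by (simp add: numeral_2_eq_2)
  have BA: "(B * elem_mat i j * A) $$ (p, q) = B $$ (p, i - 1) * A $$ (j - 1, q)" if "p < 2" "q < 2" for p q
    using that assms by (auto simp: elem_mat_def scalar_prod_def sum2)
  have "aux_entry N (site_op N E 0 A * X.R 0 n 0 * site_op N E 0 B) j i $$ (r, c)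
      = (\<Sum>a\<in>{1,2}. \<Sum>b\<in>{1,2}. A $$ (j - 1, a - 1) * aux_entry N (X.R 0 n 0) a b $$ (r, c) * B $$ (b - 1, i - 1))"
    using assms rc by (auto simp: aux_entry_site_op_0_mult algebra_simps simp del: index_mult_mat(1))
  also have "\<dots> = ((- sinh \<eta>) \<cdot>\<^sub>m site_op N D n (B * elem_mat i j * A)) $$ (r, c)"
    using assms(1) rc spin_cases[of N n r] spin_cases[of N n c]
    by (elim disjE) (auto simp: aux_entry_two_site_op_0 site_op_def H.Rbar_index BA)
  finally show "aux_entry N (site_op N E 0 A * X.R 0 n 0 * site_op N E 0 B) j i $$ (r, c)
    = ((- sinh \<eta>) \<cdot>\<^sub>m site_op N D n (B * elem_mat i j * A)) $$ (r, c)" .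
qed (auto simp: site_op_def)

lemma site_op_commute_mat_prod_R:
  assumes "{m, n} \<subseteq> {0..N}" "m \<noteq> n" "set ks \<subseteq> {0..N} - {m, n}"
  shows "site_op N E m A * mat_prod E (map (\<lambda>k. X.R n k (u k)) ks)
    = mat_prod E (map (\<lambda>k. X.R n k (u k)) ks) * site_op N E m A"
  using assms by (intro mat_prod_intertwine X.site_op_disjoint_commute) auto

text \<open>Pulling the permutation through a product replaces the auxiliary site by
  \<open>n\<close>. It is pulled through the right product first, the result is commuted past the
  left product, and the permutation is then pulled through that one as well.\<close>

lemma mat_prod_R_exchange:
  assumes n: "n \<in> {1..N}" and ks: "set ks \<subseteq> {1..N} - {n}" and ls: "set ls \<subseteq> {1..N} - {n}"
    and disj: "set ks \<inter> set ls = {}"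
  shows "mat_prod E (map (\<lambda>k. X.R 0 k (u k)) ks) * X.R 0 n 0 * mat_prod E (map (\<lambda>k. X.R 0 k (u k)) ls)
    = mat_prod E (map (\<lambda>k. X.R n k (u k)) ls) * X.R 0 n 0 * mat_prod E (map (\<lambda>k. X.R n k (u k)) ks)"
proof -
  let ?Z = "\<lambda>ks. mat_prod E (map (\<lambda>k. X.R 0 k (u k)) ks)"
  let ?K = "\<lambda>ks. mat_prod E (map (\<lambda>k. X.R n k (u k)) ks)"
  have c: "?Z ks \<in> carrier_mat E E" "?K ks \<in> carrier_mat E E" for ks
    by (auto intro!: mat_prod_carrier)
  have 1: "X.R 0 n 0 * ?Z ls = ?K ls * X.R 0 n 0"
    using n ls by (intro mat_prod_intertwine X.R_exchange) auto
  have 2: "X.R 0 n 0 * ?K ks = ?Z ks * X.R 0 n 0"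
    using n ks by (intro mat_prod_intertwine X.R_exchange[symmetric]) auto
  have "?Z ks * X.R n l (u l) = X.R n l (u l) * ?Z ks" if "l \<in> set ls" for l
    using n that ks ls disj
    by (intro mat_prod_intertwine[symmetric] X.two_site_op_disjoint_commute) auto
  \<comment> \<open>\<open>?Z ks\<close> acts in the sites 0 and \<open>ks\<close>,
    \<open>?K ls\<close> in \<open>n\<close> and \<open>ls\<close>.\<close>
  then have 3: "?Z ks * ?K ls = ?K ls * ?Z ks"
    using c by (intro mat_prod_intertwine) auto
  have "?Z ks * X.R 0 n 0 * ?Z ls = ?Z ks * ?K ls * X.R 0 n 0"
    using c by (simp add: 1)
  also have "\<dots> = ?K ls * (?Z ks * X.R 0 n 0)"
    using c by (simp only: 3 X.mult_assoc_D X.two_site_op_carrier)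
  also have "\<dots> = ?K ls * X.R 0 n 0 * ?K ks"
    using c by (simp add: 2)
  finally show ?thesis .
qed

text \<open>At \<open>u n = 0\<close> the factor of the site \<open>n\<close> is the permutation.
  After the exchange the outer products no longer involve the auxiliary space: the gauge matrices
  pass through them, and the entry is taken of the permutation between \<open>A\<close> and
  \<open>B\<close> alone.\<close>

lemma aux_entry_gauged_product:
  assumes n: "n \<in> {1..N}" and ks: "set ks \<subseteq> {1..N} - {n}" and ls: "set ls \<subseteq> {1..N} - {n}"
    and disj: "set ks \<inter> set ls = {}" and u: "u n = 0"
    and AB: "A \<in> carrier_mat 2 2" "B \<in> carrier_mat 2 2" and ij: "j \<in> {1, 2}" "i \<in> {1, 2}"
  shows "aux_entry N (site_op N E 0 A * mat_prod E (map (\<lambda>k. X.R 0 k (u k)) (ks @ [n] @ ls)) * site_op N E 0 B) j i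
    = (- sinh \<eta>) \<cdot>\<^sub>m (mat_prod D (map (\<lambda>k. H.R n k (u k)) ls) * site_op N D n (B * elem_mat i j * A)
      * mat_prod D (map (\<lambda>k. H.R n k (u k)) ks))"
proof -
  let ?Z = "\<lambda>ks. mat_prod E (map (\<lambda>k. X.R 0 k (u k)) ks)"
  let ?K = "\<lambda>ks. mat_prod E (map (\<lambda>k. X.R n k (u k)) ks)"
  let ?L = "\<lambda>ks. mat_prod D (map (\<lambda>k. H.R n k (u k)) ks)"
  let ?A = "site_op N E 0 A" and ?B = "site_op N E 0 B" and ?P = "X.R 0 n 0"
  have c: "?Z ks \<in> carrier_mat E E" "?K ks \<in> carrier_mat E E" "?L ks \<in> carrier_mat D D" for ks
    by (auto intro!: mat_prod_carrier)
  have "?Z (ks @ [n] @ ls) = ?Z ks * (?P * ?Z ls)"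
    using u by (simp add: mat_prod_append image_subset_iff)
  also have "\<dots> = ?K ls * ?P * ?K ks"
    using c mat_prod_R_exchange[OF n ks ls disj, of u] by simp
  finally have "?A * ?Z (ks @ [n] @ ls) * ?B = (?A * ?K ls) * ?P * (?K ks * ?B)"
    using c by simp
  also have "?A * ?K ls = ?K ls * ?A"
    using n ls by (intro site_op_commute_mat_prod_R) auto
  also have "?K ks * ?B = ?B * ?K ks"
    using n ks by (intro site_op_commute_mat_prod_R[symmetric]) auto
  also have "?K ls * ?A * ?P * (?B * ?K ks) = ?K ls * (?A * ?P * ?B) * ?K ks"
    using c by simp
  finally have *: "?A * ?Z (ks @ [n] @ ls) * ?B = ?K ls * (?A * ?P * ?B) * ?K ks" .
  have ext: "extends (?K ks) (?L ks)" if "set ks \<subseteq> {1..N}" for ks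
    using n that by (intro extends_mat_prod extends_R) auto
  have "aux_entry N (?K ls * (?A * ?P * ?B) * ?K ks) j i = ?L ls * aux_entry N (?A * ?P * ?B) j i * ?L ks"
    using c ks ls ij ext[of ks] ext[of ls]
    by (subst aux_entry_extends_mult(2), (auto)[4], subst aux_entry_extends_mult(1)) auto
  also have "\<dots> = (- sinh \<eta>) \<cdot>\<^sub>m (?L ls * site_op N D n (B * elem_mat i j * A) * ?L ks)"
    using n AB ij c
    by (simp add: aux_entry_permutation mult_smult_assoc_mat[of _ D D _ D]
        mult_smult_distrib[of _ D D _ D] del: X.mult_assoc_D)
  finally show ?thesis unfolding * .
qed

section \<open>Crossing symmetry\<close>

definition crossing :: "complex mat \<Rightarrow> complex mat" where
  "crossing A = site_op N E 0 sigma_y * aux_transpose N A * site_op N E 0 sigma_y"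

lemma aux_transpose_carrier [simp]: "aux_transpose N A \<in> carrier_mat E E"
  by (simp add: aux_transpose_def E_def)

lemma crossing_carrier [simp]: "crossing A \<in> carrier_mat E E"
  unfolding crossing_def by simp

lemma aux_entry_transpose:
  assumes "j \<in> {1, 2}" "i \<in> {1, 2}"
  shows "aux_entry N (aux_transpose N A) j i = aux_entry N A i j"
proof (rule aux_entry_eqI)
  fix r c assume rc: "r < D" "c < D"
  have "spin N 0 ((j - 1) * D + r) = j - 1" "spin N 0 ((i - 1) * D + c) = i - 1"
    using spin_aux_index(1)[of _ _ 0] rc assms by (simp_all del: One_nat_def)
  moreover have "((j - 1) * D + r) mod D = r" "((i - 1) * D + c) mod D = c"
    using rc by simp_all
  ultimately show "aux_entry N (aux_transpose N A) j i $$ (r, c) = aux_entry N A i j $$ (r, c)"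
    using aux_entry_mat[OF rc assms] rc unfolding aux_transpose_def E_def[symmetric] D_def[symmetric]
    by (simp add: aux_entry_index)
qed simp

text \<open>The two factors \<open>sigma_y\<close> turn the transpose into the adjugate of a 2 by 2
  matrix with operator entries.\<close>

lemma aux_entry_crossing:
  assumes "j \<in> {1, 2}" "i \<in> {1, 2}"
  shows "aux_entry N (crossing A) j i = (-1) ^ (j + i) \<cdot>\<^sub>m aux_entry N A (3 - i) (3 - j)"
proof -
  have s: "sigma_y $$ (0, 0) = 0" "sigma_y $$ (0, Suc 0) = - \<i>"
    "sigma_y $$ (Suc 0, 0) = \<i>" "sigma_y $$ (Suc 0, Suc 0) = 0"
    by (simp_all add: sigma_y_def mat_of_rows_list_def)
  show ?thesis
    using assms unfolding crossing_def
    by (auto simp: aux_entry_site_op_0_mult aux_entry_transpose s intro!: eq_matI simp del: X.mult_assoc_D)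
qed

text \<open>Like the adjugate, crossing reverses products, but with operator entries this requires
  the entries of the two factors to commute.\<close>

lemma crossing_mult:
  assumes "A \<in> carrier_mat E E" "B \<in> carrier_mat E E"
    and "\<And>j k i. \<lbrakk>j \<in> {1, 2}; k \<in> {1, 2}; i \<in> {1, 2}\<rbrakk>
      \<Longrightarrow> aux_entry N A j k * aux_entry N B k i = aux_entry N B k i * aux_entry N A j k"
  shows "crossing (A * B) = crossing B * crossing A"
proof (rule aux_eqI)
  fix j i :: nat assume ji: "j \<in> {1, 2}" "i \<in> {1, 2}"
  have cc: "3 - i \<in> {1, 2}" "3 - j \<in> {1, 2}" using ji by auto
  show "aux_entry N (crossing (A * B)) j i = aux_entry N (crossing B * crossing A) j i"
    using ji assms
    by (auto simp: aux_entry_mult aux_entry_crossing mult_smult_assoc_mat[of _ D D _ D]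
      mult_smult_distrib[of _ D D _ D] intro!: eq_matI)
qed (use assms in auto)

lemma crossing_site_op_0:
  "crossing (site_op N E 0 A) = site_op N E 0 (mat 2 2 (\<lambda>(p, q). (-1) ^ (p + q) * A $$ (1 - q, 1 - p)))"
proof (rule aux_eqI)
  fix j i :: nat assume ji: "j \<in> {1, 2}" "i \<in> {1, 2}"
  then show "aux_entry N (crossing (site_op N E 0 A)) j i
    = aux_entry N (site_op N E 0 (mat 2 2 (\<lambda>(p, q). (-1) ^ (p + q) * A $$ (1 - q, 1 - p)))) j i"
    by (auto simp: aux_entry_crossing aux_entry_site_op_0 intro!: eq_matI)
qed auto

lemma aux_entry_smult:
  assumes "A \<in> carrier_mat E E" "j \<in> {1, 2}" "i \<in> {1, 2}"
  shows "aux_entry N (x \<cdot>\<^sub>m A) j i = x \<cdot>\<^sub>m aux_entry N A j i"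
  using assms aux_less[of _ j] aux_less[of _ i] by (intro aux_entry_eqI) (auto simp: aux_entry_index)

text \<open>Crossing interchanges the weights \<open>sinh l\<close> and
  \<open>sinh (l - \<eta>)\<close>, which is also the effect of replacing \<open>l\<close> by
  \<open>\<eta> - l\<close>, up to a sign.\<close>

lemma crossing_R:
  assumes "n \<in> {1..N}"
  shows "crossing (X.R 0 n l) = (-1) \<cdot>\<^sub>m X.R 0 n (\<eta> - l)"
proof (rule aux_eqI)
  fix j i :: nat assume ji: "j \<in> {1, 2}" "i \<in> {1, 2}"
  have minus: "sinh (\<eta> - l - \<eta>) = - sinh l" "sinh (\<eta> - l) = - sinh (l - \<eta>)"
    using sinh_minus[of "l - \<eta>"] by simp_all
  have "3 - i \<in> {1, 2}" "3 - j \<in> {1, 2}" using ji by auto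
  then have "aux_entry N (crossing (X.R 0 n l)) j i = (-1) ^ (j + i) \<cdot>\<^sub>m
      site_op N D n (mat 2 2 (\<lambda>(p, q). Rbar \<eta> l $$ (2 * (3 - i - 1) + p, 2 * (3 - j - 1) + q)))"
    using assms ji by (simp add: aux_entry_crossing aux_entry_two_site_op_0)
  also have "\<dots> = (-1) \<cdot>\<^sub>m
      site_op N D n (mat 2 2 (\<lambda>(p, q). Rbar \<eta> (\<eta> - l) $$ (2 * (j - 1) + p, 2 * (i - 1) + q)))"
  proof (rule eq_matI, goal_cases)
    case (1 r c)
    then have "r < D" "c < D" by (auto simp: site_op_def)
    then show ?case
      using ji spin_cases[of N n r] spin_cases[of N n c]
      by (elim disjE insertE emptyE) (simp_all add: site_op_def H.Rbar_index minus)
  qed (auto simp: site_op_def)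
  also have "\<dots> = aux_entry N ((-1) \<cdot>\<^sub>m X.R 0 n (\<eta> - l)) j i"
    using assms ji by (simp add: aux_entry_smult aux_entry_two_site_op_0)
  finally show "aux_entry N (crossing (X.R 0 n l)) j i = aux_entry N ((-1) \<cdot>\<^sub>m X.R 0 n (\<eta> - l)) j i" .
qed auto

lemma crossing_one: "crossing (1\<^sub>m E) = 1\<^sub>m E"
proof (rule aux_eqI)
  fix j i :: nat assume ji: "j \<in> {1, 2}" "i \<in> {1, 2}"
  then show "aux_entry N (crossing (1\<^sub>m E)) j i = aux_entry N (1\<^sub>m E) j i"
    by (auto simp: aux_entry_crossing extendsD(3)[OF extends_one] intro!: eq_matI)
qed auto

lemma crossing_mat_prod:
  assumes "distinct ks" "set ks \<subseteq> {1..N}"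
  shows "crossing (mat_prod E (map (\<lambda>k. X.R 0 k (u k)) ks))
    = (-1) ^ length ks \<cdot>\<^sub>m mat_prod E (map (\<lambda>k. X.R 0 k (\<eta> - u k)) (rev ks))"
  using assms
proof (induction ks)
  case (Cons k ks)
  let ?M = "mat_prod E (map (\<lambda>k. X.R 0 k (u k)) ks)"
  let ?M' = "mat_prod E (map (\<lambda>k. X.R 0 k (\<eta> - u k)) (rev ks))"
  have c: "?M \<in> carrier_mat E E" "?M' \<in> carrier_mat E E"
    by (auto intro!: mat_prod_carrier)
  have k: "k \<in> {1..N}" using Cons.prems by simp
  have "crossing (X.R 0 k (u k) * ?M) = crossing ?M * crossing (X.R 0 k (u k))"
  proof (rule crossing_mult)
    fix j a i :: nat assume ji: "j \<in> {1, 2}" "a \<in> {1, 2}" "i \<in> {1, 2}"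
    \<comment> \<open>The auxiliary entries of the first factor are operators at the site
      \<open>k\<close>, which does not occur in \<open>?M\<close>; this yields the commutation
      required by \<open>crossing_mult\<close>.\<close>
    have "site_op N E k Z * ?M = ?M * site_op N E k Z" for Z
      using Cons.prems by (intro site_op_commute_mat_prod_R) auto
    then have "aux_entry N (site_op N E k Z * ?M) a i = aux_entry N (?M * site_op N E k Z) a i" for Z
      by simp
    then have "site_op N D k Z * aux_entry N ?M a i = aux_entry N ?M a i * site_op N D k Z" for Z
      using ji c aux_entry_extends_mult[OF extends_site_op[OF k]] by simp
    then show "aux_entry N (X.R 0 k (u k)) j a * aux_entry N ?M a i
      = aux_entry N ?M a i * aux_entry N (X.R 0 k (u k)) j a"
      using ji k by (simp add: aux_entry_two_site_op_0)
  qed (use c in auto)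
  also have "\<dots> = (-1) ^ length ks \<cdot>\<^sub>m ?M' * ((-1) \<cdot>\<^sub>m X.R 0 k (\<eta> - u k))"
    using Cons k by (simp add: crossing_R)
  also have "\<dots> = (-1) ^ Suc (length ks) \<cdot>\<^sub>m (?M' * X.R 0 k (\<eta> - u k))"
    using c by (simp add: mult_smult_assoc_mat[of _ E E _ E] mult_smult_distrib[of _ E E _ E]) (auto intro!: eq_matI)
  also have "?M' * X.R 0 k (\<eta> - u k) = mat_prod E (map (\<lambda>k. X.R 0 k (\<eta> - u k)) (rev (k # ks)))"
    by (simp add: mat_prod_append image_subset_iff right_mult_one_mat[OF X.two_site_op_carrier])
  finally show ?case by simp
qed (auto simp: crossing_one intro!: eq_matI)

end


section \<open>Reconstruction of local operators\<close>

text \<open>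
  Square matrices of a fixed size do not form a type, so the results on monoids are transferred through
  their action on vectors.
\<close>

typedef 'a endo = "UNIV :: ('a \<Rightarrow> 'a) set"
  morphisms apply_endo Endo by auto

instantiation endo :: (type) monoid_mult
begin

definition one_endo :: "'a endo" where "1 = Endo (\<lambda>x. x)"
definition times_endo :: "'a endo \<Rightarrow> 'a endo \<Rightarrow> 'a endo" where
  "f * g = Endo (apply_endo f \<circ> apply_endo g)"

instance
  by standard (simp_all add: one_endo_def times_endo_def Endo_inverse apply_endo_inverse o_def)

end

text \<open>Vectors of other dimensions are left fixed, so that the identity matrix becomes the unit
  of the monoid.\<close>

definition mat_endo :: "nat \<Rightarrow> complex mat \<Rightarrow> complex vec endo" where
  "mat_endo D A = Endo (\<lambda>v. if v \<in> carrier_vec D then A *\<^sub>v v else v)"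

lemma mat_endo_one: "mat_endo D (1\<^sub>m D) = 1"
proof -
  have "(\<lambda>v. if v \<in> carrier_vec D then 1\<^sub>m D *\<^sub>v v else v) = (\<lambda>v :: complex vec. v)" by auto
  then show ?thesis by (simp add: mat_endo_def one_endo_def)
qed

lemma mat_endo_mult:
  assumes "A \<in> carrier_mat D D" "B \<in> carrier_mat D D"
  shows "mat_endo D (A * B) = mat_endo D A * mat_endo D B"
  using assms by (auto simp: mat_endo_def times_endo_def Endo_inverse intro!: arg_cong[of _ _ Endo])

lemma mat_endo_inject:
  assumes "A \<in> carrier_mat D D" "B \<in> carrier_mat D D" "mat_endo D A = mat_endo D B"
  shows "A = B"
proof (rule eq_matI)
  fix i j assume "i < dim_row B" "j < dim_col B"
  then have ij: "i < D" "j < D" using assms by auto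
  have "A *\<^sub>v unit_vec D j = B *\<^sub>v unit_vec D j"
    using arg_cong[OF assms(3), of "\<lambda>f. apply_endo f (unit_vec D j)"] by (simp add: mat_endo_def Endo_inverse)
  then have "(A *\<^sub>v unit_vec D j) $ i = (B *\<^sub>v unit_vec D j) $ i" by simp
  then show "A $$ (i, j) = B $$ (i, j)" using ij assms by simp
qed (use assms in auto)

lemma mat_endo_mat_prod:
  "set As \<subseteq> carrier_mat D D \<Longrightarrow> mat_endo D (mat_prod D As) = prod_list (map (mat_endo D) As)"
  by (induction As) (auto simp: mat_endo_one mat_endo_mult mat_prod_carrier)

lemma mat_prod_smult:
  assumes "\<And>k. k \<in> set ks \<Longrightarrow> f k \<in> carrier_mat D D"
  shows "mat_prod D (map (\<lambda>k. c k \<cdot>\<^sub>m f k) ks) = prod_list (map c ks) \<cdot>\<^sub>m mat_prod D (map f ks)"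
  using assms
proof (induction ks)
  case (Cons k ks)
  have "f k \<in> carrier_mat D D" "mat_prod D (map f ks) \<in> carrier_mat D D"
    using Cons.prems by (auto intro!: mat_prod_carrier)
  then show ?case using Cons
    by (simp add: mult_smult_assoc_mat[of _ D D _ D] mult_smult_distrib[of _ D D _ D]) (auto intro!: eq_matI)
qed (auto intro!: eq_matI)

section \<open>Inverses, and the invertibility of the gauge matrices\<close>

lemma minv_eqI:
  assumes "A \<in> carrier_mat D D" "B \<in> carrier_mat D D" "A * B = 1\<^sub>m D" "B * A = 1\<^sub>m D"
  shows "minv A = B"
proof -
  obtain C where C: "mat_inverse A = Some C"
    using mat_inverse(1)[OF assms(1), of "()"] assms
    by (cases "mat_inverse A") (auto simp: Units_def ring_mat_simps)
  then have "C \<in> carrier_mat D D" "C * A = 1\<^sub>m D"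
    using mat_inverse(2)[OF assms(1)] by auto
  then have "C = C * (A * B)" using assms by simp
  also have "\<dots> = C * A * B" using assms \<open>C \<in> carrier_mat D D\<close> by (intro assoc_mult_mat[symmetric]) auto
  also have "\<dots> = B" using assms \<open>C * A = 1\<^sub>m D\<close> by simp
  finally show ?thesis using C by (simp add: minv_def)
qed

definition adjugate2 :: "complex mat \<Rightarrow> complex mat" where
  "adjugate2 A = mat 2 2 (\<lambda>(p, q). (-1) ^ (p + q) * A $$ (1 - q, 1 - p))"

lemma adjugate2_carrier [simp]: "adjugate2 A \<in> carrier_mat 2 2"
  by (simp add: adjugate2_def)

lemma det_2: "A \<in> carrier_mat 2 2 \<Longrightarrow> det A = A $$ (0, 0) * A $$ (1, 1) - A $$ (0, 1) * A $$ (1, 0)"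
  for A :: "complex mat"
proof -
  assume A: "A \<in> carrier_mat 2 2"
  have sum2: "sum f {..<2} = f 0 + f 1" for f :: "nat \<Rightarrow> complex"
    by (simp add: numeral_2_eq_2)
  have "mat_delete A i j \<in> carrier_mat 1 1" for i j
    using mat_delete_carrier[of A 2 2 i j] A by simp
  then have "det A = (\<Sum>j<2. A $$ (0, j) * ((-1) ^ j * mat_delete A 0 j $$ (0, 0)))"
    using A by (subst laplace_expansion_row[of _ 2 0]) (simp_all add: cofactor_def det_single)
  then show ?thesis
    using A by (simp add: sum2 mat_delete_def)
qed

lemma mat_2_eqI:
  assumes "A \<in> carrier_mat 2 2" "A' \<in> carrier_mat 2 2"
    "A $$ (0, 0) = A' $$ (0, 0)" "A $$ (0, 1) = A' $$ (0, 1)"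
    "A $$ (1, 0) = A' $$ (1, 0)" "A $$ (1, 1) = A' $$ (1, 1)"
  shows "A = A'"
  by (rule eq_matI) (use assms in \<open>auto simp: less_2_cases_iff\<close>)

text \<open>Cramer's rule; the second part holds because taking the adjugate of a 2 by 2 matrix
  twice gives it back.\<close>

lemma minv_2:
  assumes A: "A \<in> carrier_mat 2 2" and det: "det A \<noteq> 0"
  shows "minv A = (1 / det A) \<cdot>\<^sub>m adjugate2 A" "adjugate2 (minv A) = (1 / det A) \<cdot>\<^sub>m A"
proof -
  have sum2: "sum f {0..<2} = f 0 + f 1" for f :: "nat \<Rightarrow> complex"
    by (simp add: numeral_2_eq_2)
  have adj: "A * adjugate2 A = det A \<cdot>\<^sub>m 1\<^sub>m 2" "adjugate2 A * A = det A \<cdot>\<^sub>m 1\<^sub>m 2"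
    using A mult_carrier_mat[OF A adjugate2_carrier, of A] mult_carrier_mat[OF adjugate2_carrier A, of A]
    by (auto intro!: mat_2_eqI simp: det_2 adjugate2_def scalar_prod_def sum2 algebra_simps)
  show *: "minv A = (1 / det A) \<cdot>\<^sub>m adjugate2 A"
  proof (rule minv_eqI)
    show "A * ((1 / det A) \<cdot>\<^sub>m adjugate2 A) = 1\<^sub>m 2"
      using A det by (simp add: mult_smult_distrib[of _ 2 2 _ 2] adj) (auto intro!: eq_matI)
    show "(1 / det A) \<cdot>\<^sub>m adjugate2 A * A = 1\<^sub>m 2"
      using A det by (simp add: mult_smult_assoc_mat[of _ 2 2 _ 2] adj) (auto intro!: eq_matI)
  qed (use A in auto)
  show "adjugate2 (minv A) = (1 / det A) \<cdot>\<^sub>m A"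
    unfolding * using A by (intro mat_2_eqI) (auto simp: adjugate2_def)
qed

lemma gauge_carrier [simp]: "gauge \<eta> l \<alpha> \<beta> \<in> carrier_mat 2 2"
  unfolding gauge_def mat_of_rows_list_def by (rule carrier_matI) simp_all

text \<open>The determinant factors as
  \<open>- 2 * exp (l - \<eta> * \<alpha>) * sinh (\<eta> * \<beta>)\<close>.\<close>

lemma det_gauge:
  assumes "sinh (\<eta> * \<beta>) \<noteq> 0"
  shows "det (gauge \<eta> l \<alpha> \<beta>) \<noteq> 0"
proof -
  have "det (gauge \<eta> l \<alpha> \<beta>) = exp (l - \<eta> * \<alpha>) * (exp (- (\<eta> * \<beta>)) - exp (\<eta> * \<beta>))"
  proof -
    have "exp (l - \<eta> * (\<beta> + \<alpha>)) = exp (l - \<eta> * \<alpha>) * exp (- (\<eta> * \<beta>))"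
      "exp (l + \<eta> * (\<beta> - \<alpha>)) = exp (l - \<eta> * \<alpha>) * exp (\<eta> * \<beta>)"
      unfolding exp_add[symmetric] by (simp_all add: algebra_simps)
    then show ?thesis
      by (simp add: det_2) (simp add: gauge_def mat_of_rows_list_def right_diff_distrib)
  qed
  also have "exp (- (\<eta> * \<beta>)) - exp (\<eta> * \<beta>) = - 2 * sinh (\<eta> * \<beta>)"
    by (simp add: sinh_field_def)
  finally show ?thesis using assms by simp
qed

lemma minv_gauge_carrier:
  "sinh (\<eta> * \<beta>) \<noteq> 0 \<Longrightarrow> minv (gauge \<eta> l \<alpha> \<beta>) \<in> carrier_mat 2 2"
  by (simp add: minv_2 det_gauge)

lemma elem_mat_carrier [simp]: "elem_mat i j \<in> carrier_mat 2 2"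
  by (simp add: elem_mat_def)

text \<open>At a zero of \<open>sinh\<close> the exponential is 1 or -1. Its modulus makes the real
  part of the argument vanish and its imaginary part makes the argument a multiple of
  \<i>\<pi>.\<close>

lemma sinh_nonzero_if_not_excluded:
  assumes "x \<notin> excluded \<eta>" "e \<in> {0, \<eta>, - \<eta>}"
  shows "sinh (x - e) \<noteq> 0"
proof
  assume "sinh (x - e) = 0"
  then have exp: "exp (x - e) = 1 \<or> exp (x - e) = - 1" by (simp add: sinh_zero_iff)
  then have "norm (exp (x - e)) = 1" by (elim disjE) (simp_all only: norm_one norm_minus_cancel)
  then have re: "Re (x - e) = 0" unfolding norm_exp_eq_Re by simp
  have "Im (exp (x - e)) = 0" using exp by auto
  then have "sin (Im (x - e)) = 0" using re by (simp add: Im_exp)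
  then obtain m :: int where "Im (x - e) = of_int m * pi" using sin_zero_iff_int2 by blast
  then have "x = e + \<i> * of_real pi * of_int m"
    using re by (simp add: complex_eq_iff mult.commute)
  then show False using assms unfolding excluded_def by blast
qed


text \<open>The case \<open>j = k\<close> of the assumption says that \<open>sinh \<eta>\<close> is
  nonzero, so a single condition covers the normalisations and the factor of the
  permutation.\<close>

locale inhomogeneous_chain = auxiliary_space +
  fixes \<xi> :: "nat \<Rightarrow> complex"
  assumes generic: "\<lbrakk>j \<in> {1..N}; k \<in> {1..N}\<rbrakk> \<Longrightarrow> sinh (\<xi> j - \<xi> k - \<eta>) \<noteq> 0"
begin

text \<open>Normalised so that unitarity holds without a scalar factor.\<close>

definition r :: "nat \<Rightarrow> nat \<Rightarrow> complex mat" where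
  "r j k = (1 / sinh (\<xi> j - \<xi> k - \<eta>)) \<cdot>\<^sub>m H.R j k (\<xi> j - \<xi> k)"

lemma r_carrier [simp]: "r j k \<in> carrier_mat D D"
  by (simp add: r_def)

lemmas smult_mult = mult_smult_assoc_mat[of _ D D _ D] mult_smult_distrib[of _ D D _ D]

lemma smult_smult: "a \<cdot>\<^sub>m (b \<cdot>\<^sub>m A) = (a * b) \<cdot>\<^sub>m A" for a b :: complex
  by (auto intro!: eq_matI)

lemma smult_one: "(1 :: complex) \<cdot>\<^sub>m A = A"
  by (auto intro!: eq_matI)

lemma smult_sandwich:
  fixes a b :: complex
  assumes "X \<in> carrier_mat D D" "Y \<in> carrier_mat D D" "Z \<in> carrier_mat D D"
  shows "(a \<cdot>\<^sub>m X) * Y * (b \<cdot>\<^sub>m Z) = (a * b) \<cdot>\<^sub>m (X * Y * Z)"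
  using assms by (simp add: smult_mult smult_smult mult.commute)

sublocale exchange_chain "\<lambda>j k. mat_endo D (r j k)" N
proof unfold_locales
  fix j k assume jk: "j \<in> {1..N}" "k \<in> {1..N}" "j \<noteq> k"
  have "sinh (\<xi> j - \<xi> k - \<eta>) \<noteq> 0" "sinh (\<xi> k - \<xi> j - \<eta>) \<noteq> 0"
    using generic jk by auto
  then have "r j k * r k j = 1\<^sub>m D"
    using H.R_unitarity[of j k "\<xi> j - \<xi> k"] jk
    by (simp add: r_def smult_mult smult_smult) (auto intro!: eq_matI)
  then show "mat_endo D (r j k) * mat_endo D (r k j) = 1"
    by (simp flip: mat_endo_mult add: mat_endo_one)
next
  fix j k l m assume "{j, k, l, m} \<subseteq> {1..N}" "j \<noteq> k" "l \<noteq> m" "{j, k} \<inter> {l, m} = {}"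
  then have "r j k * r l m = r l m * r j k"
    using H.two_site_op_disjoint_commute[of j k l m] by (simp add: r_def smult_mult smult_smult mult.commute)
  then show "mat_endo D (r j k) * mat_endo D (r l m) = mat_endo D (r l m) * mat_endo D (r j k)"
    by (simp flip: mat_endo_mult)
next
  fix n j k assume njk: "{n, j, k} \<subseteq> {1..N}" "distinct [n, j, k]"
  \<comment> \<open>The parameters \<open>\<xi> n - \<xi> j\<close> and
    \<open>\<xi> j - \<xi> k\<close> add up to \<open>\<xi> n - \<xi> k\<close>, as the Yang-Baxter
    equation requires.\<close>
  have "r n j * r n k * r j k = r j k * r n k * r n j"
    using H.R_yang_baxter[of j k n "\<xi> n - \<xi> j" "\<xi> j - \<xi> k"] njk
    by (simp add: r_def smult_mult smult_smult mult_ac)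
  then show "mat_endo D (r n j) * mat_endo D (r n k) * mat_endo D (r j k)
      = mat_endo D (r j k) * mat_endo D (r n k) * mat_endo D (r n j)"
    by (simp flip: mat_endo_mult del: H.mult_assoc_D)
qed

section \<open>Matrix forms of the products in the monoid\<close>

definition K :: "nat \<Rightarrow> complex mat" where "K n = mat_prod D (map (r n) (rev [1..<n]))"
definition L :: "nat \<Rightarrow> complex mat" where "L n = mat_prod D (map (r n) (rev [n + 1..<N + 1]))"
definition Ki :: "nat \<Rightarrow> complex mat" where "Ki n = mat_prod D (map (\<lambda>k. r k n) [1..<n])"
definition Li :: "nat \<Rightarrow> complex mat" where "Li n = mat_prod D (map (\<lambda>k. r k n) [n + 1..<N + 1])"

lemma KL_carrier [simp]:
  "K n \<in> carrier_mat D D" "L n \<in> carrier_mat D D" "Ki n \<in> carrier_mat D D" "Li n \<in> carrier_mat D D"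
  unfolding K_def L_def Ki_def Li_def by (auto intro!: mat_prod_carrier simp del: upt_Suc)

lemma mat_endo_KL:
  "mat_endo D (K n) = lower n" "mat_endo D (L n) = upper n"
  "mat_endo D (Ki n) = lower_inv n" "mat_endo D (Li n) = upper_inv n"
  by (simp_all add: K_def L_def Ki_def Li_def mat_endo_mat_prod image_subset_iff lower_def upper_def
    lower_inv_def upper_inv_def row_def column_def o_def rev_map del: upt_Suc)

definition F :: "nat \<Rightarrow> complex mat" where "F m = mat_prod D (map (\<lambda>k. K k * L k) [1..<m + 1])"
definition B :: "nat \<Rightarrow> complex mat" where "B m = mat_prod D (map (\<lambda>k. Li k * Ki k) [1..<m + 1])"

lemma FB_carrier [simp]: "F m \<in> carrier_mat D D" "B m \<in> carrier_mat D D"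
  unfolding F_def B_def by (auto intro!: mat_prod_carrier simp del: upt_Suc)

lemma mat_endo_FB: "mat_endo D (F m) = forward m" "mat_endo D (B m) = backward m"
  by (simp_all add: F_def B_def mat_endo_mat_prod image_subset_iff forward_def backward_def o_def
    mat_endo_mult mat_endo_KL del: upt_Suc)

lemma reconstruction:
  assumes n: "n \<in> {1..N}"
  shows "F (n - 1) * (K n * site_op N D n A * L n) * B n = site_op N D n A"
    and "F n * (Li n * site_op N D n A * Ki n) * B (n - 1) = site_op N D n A"
proof -
  let ?A = "mat_endo D (site_op N D n A)"
  have "?A * mat_endo D (r j k) = mat_endo D (r j k) * ?A" if "{j, k} \<subseteq> {1..N} - {n}" "j \<noteq> k" for j k
  proof -
    have "site_op N D n A * r j k = r j k * site_op N D n A"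
      using that n H.site_op_disjoint_commute[of j k n A] by (auto simp add: r_def smult_mult)
    then show ?thesis by (simp flip: mat_endo_mult)
  qed
  note rec = local_operator_reconstruction[of n ?A, OF n this]
  show "F (n - 1) * (K n * site_op N D n A * L n) * B n = site_op N D n A"
    by (rule mat_endo_inject[of _ D])
      (use rec(1) in \<open>simp_all add: mat_endo_mult mat_endo_KL mat_endo_FB mult.assoc del: upt_Suc One_nat_def\<close>)
  show "F n * (Li n * site_op N D n A * Ki n) * B (n - 1) = site_op N D n A"
    by (rule mat_endo_inject[of _ D])
      (use rec(2) in \<open>simp_all add: mat_endo_mult mat_endo_KL mat_endo_FB mult.assoc del: upt_Suc One_nat_def\<close>)
qed

text \<open>The scalar between t_n and \<open>K n * L n\<close>: the factors
  \<open>k \<noteq> n\<close> undo the normalisation of \<open>r n k\<close>, and the factor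
  \<open>k = n\<close> is the coefficient \<open>- sinh \<eta>\<close> of the permutation.\<close>

definition \<tau> :: "nat \<Rightarrow> complex" where
  "\<tau> n = (\<Prod>k\<in>{1..N}. sinh (\<xi> n - \<xi> k - \<eta>))"

lemma split_sites: "n \<in> {1..N} \<Longrightarrow> [1..<N + 1] = [1..<n] @ [n] @ [n + 1..<N + 1]"
  using upt_add_eq_append[of 1 n "N + 1 - n"] by (simp add: upt_conv_Cons)

lemma prod_sites:
  fixes g :: "nat \<Rightarrow> complex"
  assumes "n \<in> {1..N}"
  shows "(\<Prod>k\<in>{1..N}. g k) = g n * (prod_list (map g [1..<n]) * prod_list (map g [n + 1..<N + 1]))"
proof -
  have "(\<Prod>k\<in>{1..N}. g k) = prod_list (map g [1..<N + 1])"
    by (subst prod.distinct_set_conv_list[symmetric]) (auto intro!: prod.cong)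
  then show ?thesis
    unfolding split_sites[OF assms] by (simp add: mult_ac del: upt_Suc)
qed

lemma \<tau>_nonzero: "n \<in> {1..N} \<Longrightarrow> \<tau> n \<noteq> 0"
  using generic by (simp add: \<tau>_def)

lemma R_eq_r:
  assumes "n \<in> {1..N}" "set ks \<subseteq> {1..N} - {n}"
  shows "mat_prod D (map (\<lambda>k. H.R n k (\<xi> n - \<xi> k)) ks)
      = prod_list (map (\<lambda>k. sinh (\<xi> n - \<xi> k - \<eta>)) ks) \<cdot>\<^sub>m mat_prod D (map (r n) ks)"
    and "mat_prod D (map (\<lambda>k. H.R n k (\<xi> k - \<xi> n)) ks)
      = prod_list (map (\<lambda>k. sinh (\<xi> k - \<xi> n - \<eta>)) ks) \<cdot>\<^sub>m mat_prod D (map (\<lambda>k. r k n) ks)"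
proof -
  have "H.R n k (\<xi> n - \<xi> k) = sinh (\<xi> n - \<xi> k - \<eta>) \<cdot>\<^sub>m r n k" if "k \<in> set ks" for k
  proof -
    have "k \<in> {1..N}" using assms that by auto
    then show ?thesis using generic[OF assms(1)] by (auto simp: r_def intro!: eq_matI)
  qed
  then show "mat_prod D (map (\<lambda>k. H.R n k (\<xi> n - \<xi> k)) ks)
      = prod_list (map (\<lambda>k. sinh (\<xi> n - \<xi> k - \<eta>)) ks) \<cdot>\<^sub>m mat_prod D (map (r n) ks)"
    by (subst mat_prod_smult[symmetric]) (auto intro!: arg_cong[of _ _ "mat_prod D"])
  have "H.R n k (\<xi> k - \<xi> n) = sinh (\<xi> k - \<xi> n - \<eta>) \<cdot>\<^sub>m r k n" if "k \<in> set ks" for k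
  proof -
    have "k \<in> {1..N}" "k \<noteq> n" using assms that by auto
    then show ?thesis using generic[OF _ assms(1)] H.R_symmetric[of n k] assms(1)
      by (auto simp: r_def intro!: eq_matI)
  qed
  then show "mat_prod D (map (\<lambda>k. H.R n k (\<xi> k - \<xi> n)) ks)
      = prod_list (map (\<lambda>k. sinh (\<xi> k - \<xi> n - \<eta>)) ks) \<cdot>\<^sub>m mat_prod D (map (\<lambda>k. r k n) ks)"
    by (subst mat_prod_smult[symmetric]) (auto intro!: arg_cong[of _ _ "mat_prod D"])
qed

section \<open>Monodromy and transfer matrices at the shifted inhomogeneities\<close>

lemma monodromy_eq:
  "monodromy \<eta> \<xi> N l = mat_prod E (map (\<lambda>k. X.R 0 k (l - \<xi> k + \<eta> / 2)) (rev [1..<N + 1]))"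
  by (simp add: monodromy_def E_def)

lemma aux_entry_monodromy:
  assumes n: "n \<in> {1..N}" and ij: "j \<in> {1, 2}" "i \<in> {1, 2}"
    and A: "A \<in> carrier_mat 2 2" "A' \<in> carrier_mat 2 2"
  shows "aux_entry N (site_op N E 0 A * monodromy \<eta> \<xi> N (\<xi> n - \<eta> / 2) * site_op N E 0 A') j i
    = \<tau> n \<cdot>\<^sub>m (K n * site_op N D n (A' * elem_mat i j * A) * L n)"
proof -
  \<comment> \<open>The monodromy matrix has the sites above \<open>n\<close> to the left of the
    permutation. The exchange swaps the two sides, so \<open>K n\<close>, built from the sites below
    \<open>n\<close>, comes first.\<close>
  let ?ks = "rev [n + 1..<N + 1]" and ?ls = "rev [1..<n]"
  let ?f = "\<lambda>ks. prod_list (map (\<lambda>k. sinh (\<xi> n - \<xi> k - \<eta>)) ks)"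
  let ?S = "site_op N D n (A' * elem_mat i j * A)"
  have ks: "set ?ks \<subseteq> {1..N} - {n}" "set ?ls \<subseteq> {1..N} - {n}" "set ?ks \<inter> set ?ls = {}"
    using n by auto
  have "monodromy \<eta> \<xi> N (\<xi> n - \<eta> / 2) = mat_prod E (map (\<lambda>k. X.R 0 k (\<xi> n - \<xi> k)) (?ks @ [n] @ ?ls))"
    unfolding monodromy_eq split_sites[OF n] by (simp del: upt_Suc)
  then have "aux_entry N (site_op N E 0 A * monodromy \<eta> \<xi> N (\<xi> n - \<eta> / 2) * site_op N E 0 A') j i
    = (- sinh \<eta>) \<cdot>\<^sub>m (mat_prod D (map (\<lambda>k. H.R n k (\<xi> n - \<xi> k)) ?ls) * ?S
      * mat_prod D (map (\<lambda>k. H.R n k (\<xi> n - \<xi> k)) ?ks))"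
    by (simp only:) (rule aux_entry_gauged_product[OF n ks _ A ij], simp)
  also have "\<dots> = (- sinh \<eta>) \<cdot>\<^sub>m ((?f ?ls \<cdot>\<^sub>m K n) * ?S * (?f ?ks \<cdot>\<^sub>m L n))"
    unfolding R_eq_r(1)[OF n ks(1)] R_eq_r(1)[OF n ks(2)] K_def L_def ..
  also have "\<dots> = (- sinh \<eta> * (?f ?ls * ?f ?ks)) \<cdot>\<^sub>m (K n * ?S * L n)"
    by (simp only: smult_sandwich KL_carrier H.site_op_carrier smult_smult)
  also have "- sinh \<eta> * (?f ?ls * ?f ?ks) = \<tau> n"
    unfolding \<tau>_def prod_sites[OF n] by (simp add: rev_map[symmetric] prod_list.rev del: upt_Suc)
  finally show ?thesis .
qed

definition \<tau>' :: "nat \<Rightarrow> complex" where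
  "\<tau>' n = (\<Prod>k\<in>{1..N}. sinh (\<xi> n - \<xi> k + \<eta>))"

lemma \<tau>'_nonzero: "n \<in> {1..N} \<Longrightarrow> \<tau>' n \<noteq> 0"
proof -
  assume n: "n \<in> {1..N}"
  have "sinh (\<xi> n - \<xi> k + \<eta>) = - sinh (\<xi> k - \<xi> n - \<eta>)" for k
    using sinh_minus[of "\<xi> k - \<xi> n - \<eta>"] by (simp add: algebra_simps)
  then show ?thesis using generic[OF _ n] by (simp add: \<tau>'_def)
qed

text \<open>The shifts by \<eta>/2 make \<open>a_fun\<close> equal to \<open>\<tau>' n\<close> and
  \<open>d_fun\<close> equal to \<open>\<tau> n\<close>.\<close>

lemma detq_eq: "detq \<eta> \<xi> N (\<xi> n) = \<tau>' n * \<tau> n"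
  by (simp add: detq_def a_fun_def d_fun_def \<tau>_def \<tau>'_def algebra_simps)

text \<open>Crossing turns the argument \<open>\<xi> n - \<xi> k + \<eta>\<close> of each factor
  into \<open>\<xi> k - \<xi> n\<close>, so the site \<open>n\<close> again carries the permutation.
  The order of the factors is reversed, which yields the inverses of \<open>K n\<close> and
  \<open>L n\<close>.\<close>

lemma aux_entry_crossing_monodromy:
  assumes n: "n \<in> {1..N}" and ij: "j \<in> {1, 2}" "i \<in> {1, 2}"
    and A: "A \<in> carrier_mat 2 2" "A' \<in> carrier_mat 2 2"
  shows "aux_entry N (site_op N E 0 A * crossing (monodromy \<eta> \<xi> N (\<xi> n + \<eta> / 2)) * site_op N E 0 A') j i
    = \<tau>' n \<cdot>\<^sub>m (Li n * site_op N D n (A' * elem_mat i j * A) * Ki n)"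
proof -
  let ?ks = "[1..<n]" and ?ls = "[n + 1..<N + 1]"
  let ?g = "\<lambda>k. sinh (\<xi> k - \<xi> n - \<eta>)"
  let ?f = "\<lambda>ks. prod_list (map ?g ks)"
  let ?S = "site_op N D n (A' * elem_mat i j * A)"
  let ?M = "mat_prod E (map (\<lambda>k. X.R 0 k (\<xi> k - \<xi> n)) (?ks @ [n] @ ?ls))"
  have ks: "set ?ks \<subseteq> {1..N} - {n}" "set ?ls \<subseteq> {1..N} - {n}" "set ?ks \<inter> set ?ls = {}"
    using n by auto
  have M: "?M \<in> carrier_mat E E"
    by (intro mat_prod_carrier) (auto simp del: upt_Suc)
  have arg: "\<eta> - (\<xi> n + \<eta> / 2 - \<xi> k + \<eta> / 2) = \<xi> k - \<xi> n" for k
    by (simp add: field_simps)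
  have "crossing (monodromy \<eta> \<xi> N (\<xi> n + \<eta> / 2)) = (-1) ^ N \<cdot>\<^sub>m ?M"
    unfolding monodromy_eq split_sites[OF n, symmetric]
    by (subst crossing_mat_prod) (auto simp: arg simp del: upt_Suc)
  then have "aux_entry N (site_op N E 0 A * crossing (monodromy \<eta> \<xi> N (\<xi> n + \<eta> / 2)) * site_op N E 0 A') j i
    = (-1) ^ N \<cdot>\<^sub>m aux_entry N (site_op N E 0 A * ?M * site_op N E 0 A') j i"
    using M ij by (simp add: mult_smult_assoc_mat[of _ E E _ E] mult_smult_distrib[of _ E E _ E]
      aux_entry_smult del: upt_Suc)
  also have "aux_entry N (site_op N E 0 A * ?M * site_op N E 0 A') j i
    = (- sinh \<eta>) \<cdot>\<^sub>m (mat_prod D (map (\<lambda>k. H.R n k (\<xi> k - \<xi> n)) ?ls) * ?S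
      * mat_prod D (map (\<lambda>k. H.R n k (\<xi> k - \<xi> n)) ?ks))"
    by (rule aux_entry_gauged_product[OF n ks _ A ij]) simp
  also have "\<dots> = (- sinh \<eta>) \<cdot>\<^sub>m ((?f ?ls \<cdot>\<^sub>m Li n) * ?S * (?f ?ks \<cdot>\<^sub>m Ki n))"
    unfolding R_eq_r(2)[OF n ks(1)] R_eq_r(2)[OF n ks(2)] Ki_def Li_def ..
  also have "\<dots> = (- sinh \<eta> * (?f ?ls * ?f ?ks)) \<cdot>\<^sub>m (Li n * ?S * Ki n)"
    by (simp only: smult_sandwich KL_carrier H.site_op_carrier smult_smult)
  also have "- sinh \<eta> * (?f ?ls * ?f ?ks) = (\<Prod>k\<in>{1..N}. ?g k)"
    unfolding prod_sites[OF n] by (simp del: upt_Suc)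
  \<comment> \<open>Reversing the \<open>N\<close> arguments produces the sign that cancels the one
    from crossing.\<close>
  also have "\<dots> = (\<Prod>k\<in>{1..N}. (-1) * sinh (\<xi> n - \<xi> k + \<eta>))"
    using sinh_minus by (intro prod.cong) (simp_all add: algebra_simps flip: sinh_minus)
  also have "\<dots> = (-1) ^ N * \<tau>' n"
    unfolding prod.distrib \<tau>'_def by simp
  finally show ?thesis
    by (simp add: smult_smult power_mult_distrib[symmetric] flip: mult.assoc)
qed

lemma site_op_one: "site_op N E 0 (1\<^sub>m 2) = 1\<^sub>m E"
  by (rule aux_eqI) (auto simp: aux_entry_site_op_0 extendsD(3)[OF extends_one] intro!: eq_matI)

lemma site_op_elem_sum:
  assumes "n \<in> {1..N}"
  shows "site_op N D n (elem_mat 1 1) + site_op N D n (elem_mat 2 2) = 1\<^sub>m D"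
proof (rule eq_matI, goal_cases)
  case (1 r c)
  then have rc: "r < D" "c < D" by auto
  have "(\<forall>k\<in>{0..N} - {n}. spin N k r = spin N k c) \<and> spin N n r = spin N n c \<longleftrightarrow> r = c"
    using H.index_eqI[OF rc] assms by (metis DiffI atLeastAtMost_iff empty_iff insert_iff le0)
  then show ?case
    using rc spin_cases[of N n r] spin_cases[of N n c]
    by (elim disjE) (auto simp: site_op_def elem_mat_def)
qed (auto simp: site_op_def)

text \<open>Without gauge matrices the trace adds the two diagonal elementary matrices, which sum to
  the identity between \<open>K n\<close> and \<open>L n\<close>.\<close>

lemma transfer_eq:
  assumes n: "n \<in> {1..N}"
  shows "transfer \<eta> \<xi> N (\<xi> n - \<eta> / 2) = \<tau> n \<cdot>\<^sub>m (K n * L n)"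
proof -
  let ?S = "\<lambda>i. site_op N D n (elem_mat i i)"
  have M: "monodromy \<eta> \<xi> N l \<in> carrier_mat E E" for l
    unfolding monodromy_eq by (intro mat_prod_carrier) auto
  have "aux_entry N (monodromy \<eta> \<xi> N (\<xi> n - \<eta> / 2)) i i = \<tau> n \<cdot>\<^sub>m (K n * ?S i * L n)" if "i \<in> {1, 2}" for i
    using aux_entry_monodromy[OF n that that, of "1\<^sub>m 2" "1\<^sub>m 2"] M
    by (simp add: site_op_one left_mult_one_mat[OF M] right_mult_one_mat[OF M]
      left_mult_one_mat[OF elem_mat_carrier] right_mult_one_mat[OF elem_mat_carrier])
  then have "transfer \<eta> \<xi> N (\<xi> n - \<eta> / 2) = \<tau> n \<cdot>\<^sub>m (K n * ?S 1 * L n) + \<tau> n \<cdot>\<^sub>m (K n * ?S 2 * L n)"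
    by (simp add: transfer_def aux_trace_def)
  also have "\<dots> = \<tau> n \<cdot>\<^sub>m (K n * (?S 1 + ?S 2) * L n)"
    by (simp add: add_smult_distrib_left_mat[of _ D D] mult_add_distrib_mat[of "K n" D D "?S 1" D "?S 2"]
      add_mult_distrib_mat[of "K n * ?S 1" D D "K n * ?S 2" "L n" D] del: H.mult_assoc_D One_nat_def)
  finally show ?thesis
    unfolding site_op_elem_sum[OF n] by (simp add: right_mult_one_mat[OF KL_carrier(1)] del: H.mult_assoc_D)
qed

lemma KL_inverse:
  assumes n: "n \<in> {1..N}"
  shows "K n * L n * (Li n * Ki n) = 1\<^sub>m D" "Li n * Ki n * (K n * L n) = 1\<^sub>m D"
proof -
  have *: "x * (y * (y' * x')) = 1" if "y * y' = 1" "x * x' = 1" for x y y' x' :: "complex vec endo"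
    using that by (metis mult.assoc mult_1_left)
  show "K n * L n * (Li n * Ki n) = 1\<^sub>m D"
    by (rule mat_endo_inject[of _ D])
      (simp_all add: mat_endo_mult mat_endo_KL mat_endo_one * lower_upper_inverse[OF n])
  show "Li n * Ki n * (K n * L n) = 1\<^sub>m D"
    by (rule mat_endo_inject[of _ D])
      (simp_all add: mat_endo_mult mat_endo_KL mat_endo_one * lower_upper_inverse[OF n])
qed

lemma transfer_inverse:
  assumes n: "n \<in> {1..N}"
  shows "minv (transfer \<eta> \<xi> N (\<xi> n - \<eta> / 2)) = (1 / \<tau> n) \<cdot>\<^sub>m (Li n * Ki n)"
    and "invertible_mat (transfer \<eta> \<xi> N (\<xi> n - \<eta> / 2))"
proof -
  let ?T = "\<tau> n \<cdot>\<^sub>m (K n * L n)" and ?I = "(1 / \<tau> n) \<cdot>\<^sub>m (Li n * Ki n)"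
  have c: "K n * L n \<in> carrier_mat D D" "Li n * Ki n \<in> carrier_mat D D" by simp_all
  have inv: "?T * ?I = 1\<^sub>m D" "?I * ?T = 1\<^sub>m D"
    using c \<tau>_nonzero[OF n]
    by (simp_all only: smult_mult smult_carrier_mat KL_inverse[OF n] smult_smult) (auto intro!: eq_matI)
  show "minv (transfer \<eta> \<xi> N (\<xi> n - \<eta> / 2)) = ?I"
    unfolding transfer_eq[OF n] using inv c by (intro minv_eqI[of _ D]) auto
  show "invertible_mat (transfer \<eta> \<xi> N (\<xi> n - \<eta> / 2))"
    unfolding transfer_eq[OF n] invertible_mat_def inverts_mat_def using inv c
    by (intro conjI exI[of _ ?I]) (auto simp: carrier_matD[OF KL_carrier(1)] carrier_matD[OF KL_carrier(2)]
      carrier_matD[OF KL_carrier(3)] carrier_matD[OF KL_carrier(4)])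
qed

definition \<kappa> :: "nat \<Rightarrow> complex" where "\<kappa> m = prod_list (map \<tau> [1..<m + 1])"

lemma transfer_products:
  assumes "m \<le> N"
  shows "transfer_prod \<eta> \<xi> N m = \<kappa> m \<cdot>\<^sub>m F m" "transfer_inv_prod \<eta> \<xi> N m = (1 / \<kappa> m) \<cdot>\<^sub>m B m" "\<kappa> m \<noteq> 0"
proof -
  have m: "k \<in> {1..N}" if "k \<in> set [1..<m + 1]" for k using that assms by auto
  have "map (\<lambda>k. transfer \<eta> \<xi> N (\<xi> k - \<eta> / 2)) [1..<m + 1] = map (\<lambda>k. \<tau> k \<cdot>\<^sub>m (K k * L k)) [1..<m + 1]"
    by (rule map_cong[OF refl]) (rule transfer_eq[OF m])
  then show "transfer_prod \<eta> \<xi> N m = \<kappa> m \<cdot>\<^sub>m F m"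
    unfolding transfer_prod_def F_def \<kappa>_def D_def[symmetric] by (simp only:) (rule mat_prod_smult, simp)
  have "map (\<lambda>k. minv (transfer \<eta> \<xi> N (\<xi> k - \<eta> / 2))) [1..<m + 1]
      = map (\<lambda>k. (1 / \<tau> k) \<cdot>\<^sub>m (Li k * Ki k)) [1..<m + 1]"
    by (rule map_cong[OF refl]) (rule transfer_inverse[OF m])
  moreover have "1 / \<kappa> m = prod_list (map (\<lambda>k. 1 / \<tau> k) [1..<m + 1])"
  proof -
    have "1 / prod_list (map \<tau> ks) = prod_list (map (\<lambda>k. 1 / \<tau> k) ks)" for ks
    proof (induction ks)
      case (Cons k ks)
      then show ?case by (simp flip: Cons.IH)
    qed simp
    then show ?thesis unfolding \<kappa>_def .
  qed
  ultimately show "transfer_inv_prod \<eta> \<xi> N m = (1 / \<kappa> m) \<cdot>\<^sub>m B m"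
    unfolding transfer_inv_prod_def B_def D_def[symmetric] by (simp only:) (rule mat_prod_smult, simp)
  show "\<kappa> m \<noteq> 0"
    unfolding \<kappa>_def prod_list_zero_iff set_map by (metis imageE m \<tau>_nonzero)
qed

lemma \<kappa>_pred: "n \<in> {1..N} \<Longrightarrow> \<kappa> n = \<kappa> (n - 1) * \<tau> n"
  by (cases n) (simp_all add: \<kappa>_def)

text \<open>Only scalars are added to \<open>reconstruction\<close>: the two transfer products
  differ by one factor, so the quotient of their scalars is \<open>\<tau> n\<close> or its
  inverse.\<close>

lemma transfer_reconstruction:
  assumes n: "n \<in> {1..N}"
  shows "transfer_prod \<eta> \<xi> N (n - 1) * (\<tau> n \<cdot>\<^sub>m (K n * site_op N D n A * L n)) * transfer_inv_prod \<eta> \<xi> N n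
      = site_op N D n A"
    and "transfer_prod \<eta> \<xi> N n * (x \<cdot>\<^sub>m (Li n * site_op N D n A * Ki n)) * transfer_inv_prod \<eta> \<xi> N (n - 1)
      = (x * \<tau> n) \<cdot>\<^sub>m site_op N D n A"
proof -
  have nN: "n \<le> N" "n - 1 \<le> N" using n by auto
  have sand: "(a \<cdot>\<^sub>m X) * (y \<cdot>\<^sub>m Y) * (b \<cdot>\<^sub>m Z) = (a * y * b) \<cdot>\<^sub>m (X * Y * Z)"
    if "X \<in> carrier_mat D D" "Y \<in> carrier_mat D D" "Z \<in> carrier_mat D D" for a y b :: complex and X Y Z
    using that by (simp add: smult_mult smult_smult mult_ac)
  have car: "K n * site_op N D n A * L n \<in> carrier_mat D D" "Li n * site_op N D n A * Ki n \<in> carrier_mat D D"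
    by simp_all
  have s: "\<kappa> (n - 1) * \<tau> n * (1 / \<kappa> n) = 1" "\<kappa> n * x * (1 / \<kappa> (n - 1)) = x * \<tau> n"
    using transfer_products(3)[OF nN(1)] transfer_products(3)[OF nN(2)] \<tau>_nonzero[OF n] \<kappa>_pred[OF n]
    by (simp_all add: field_simps)
  show "transfer_prod \<eta> \<xi> N (n - 1) * (\<tau> n \<cdot>\<^sub>m (K n * site_op N D n A * L n)) * transfer_inv_prod \<eta> \<xi> N n
      = site_op N D n A"
    unfolding transfer_products(1)[OF nN(2)] transfer_products(2)[OF nN(1)]
    by (simp only: sand FB_carrier car s reconstruction[OF n]) (auto intro!: eq_matI)
  show "transfer_prod \<eta> \<xi> N n * (x \<cdot>\<^sub>m (Li n * site_op N D n A * Ki n)) * transfer_inv_prod \<eta> \<xi> N (n - 1)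
      = (x * \<tau> n) \<cdot>\<^sub>m site_op N D n A"
    unfolding transfer_products(1)[OF nN(1)] transfer_products(2)[OF nN(2)]
    by (simp only: sand FB_carrier car s reconstruction[OF n])
qed

section \<open>The three reconstruction formulas\<close>

lemma site_op_triple:
  assumes "n \<in> {1..N}" "A \<in> carrier_mat 2 2" "A' \<in> carrier_mat 2 2"
  shows "site_op N D n A * site_op N D n (elem_mat i j) * site_op N D n A' = site_op N D n (A * elem_mat i j * A')"
  using assms by (simp only: H.site_op_mult elem_mat_carrier mult_carrier_mat[of _ 2 2 _ 2])

lemma gauged_elem_eq:
  assumes "n \<in> {1..N}" "sinh (\<eta> * \<beta>) \<noteq> 0"
  shows "gauged_elem \<eta> N n i j (\<xi> n) (\<alpha>, \<beta>) (\<gamma>, \<delta>)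
    = site_op N D n (gauge \<eta> (- \<xi> n) \<gamma> \<delta> * elem_mat i j * minv (gauge \<eta> (- \<xi> n) \<alpha> \<beta>))"
  unfolding gauged_elem_def D_def[symmetric] prod.case
  using assms by (intro site_op_triple gauge_carrier minv_gauge_carrier)

lemma reconstruction_by_monodromy:
  assumes n: "n \<in> {1..N}" and ij: "i \<in> {1, 2}" "j \<in> {1, 2}" and \<beta>: "sinh (\<eta> * \<beta>) \<noteq> 0"
  shows "gauged_elem \<eta> N n i j (\<xi> n) (\<alpha>, \<beta>) (\<gamma>, \<delta>)
    = transfer_prod \<eta> \<xi> N (n - 1)
      * aux_entry N (gauged_monodromy \<eta> \<xi> N (\<xi> n - \<eta> / 2) (\<alpha>, \<beta>) (\<gamma>, \<delta>)) j i
      * transfer_inv_prod \<eta> \<xi> N n"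
proof -
  \<comment> \<open>At this spectral parameter the gauge matrices have the argument of those in the
    local operator.\<close>
  have arg: "- \<eta> / 2 - (\<xi> n - \<eta> / 2) = - \<xi> n" by simp
  have "aux_entry N (gauged_monodromy \<eta> \<xi> N (\<xi> n - \<eta> / 2) (\<alpha>, \<beta>) (\<gamma>, \<delta>)) j i
      = \<tau> n \<cdot>\<^sub>m (K n * site_op N D n (gauge \<eta> (- \<xi> n) \<gamma> \<delta> * elem_mat i j * minv (gauge \<eta> (- \<xi> n) \<alpha> \<beta>)) * L n)"
    unfolding gauged_monodromy_def prod.case arg E_def[symmetric]
    by (rule aux_entry_monodromy[OF n ij(2) ij(1) minv_gauge_carrier[OF \<beta>] gauge_carrier])
  then show ?thesis
    unfolding gauged_elem_eq[OF n \<beta>] by (simp only: transfer_reconstruction(1)[OF n])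
qed

lemma reconstruction_by_monodromy_hat:
  assumes n: "n \<in> {1..N}" and ij: "i \<in> {1, 2}" "j \<in> {1, 2}" and \<delta>: "sinh (\<eta> * \<delta>) \<noteq> 0"
  shows "gauged_elem \<eta> N n i j (\<xi> n) (\<gamma>, \<delta>) (\<alpha>, \<beta>)
    = (-1) ^ N \<cdot>\<^sub>m (transfer_prod \<eta> \<xi> N n
      * ((1 / detq \<eta> \<xi> N (\<xi> n)) \<cdot>\<^sub>m
          aux_entry N (gauged_monodromy_hat \<eta> \<xi> N (- \<eta> / 2 - \<xi> n) (\<alpha>, \<beta>) (\<gamma>, \<delta>)) j i)
      * transfer_inv_prod \<eta> \<xi> N (n - 1))"
proof -
  let ?A = "minv (gauge \<eta> (- \<xi> n) \<gamma> \<delta>)" and ?B = "gauge \<eta> (- \<xi> n) \<alpha> \<beta>"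
  let ?C = "crossing (monodromy \<eta> \<xi> N (\<xi> n + \<eta> / 2))"
  have arg: "- \<eta> / 2 - \<xi> n + \<eta> / 2 = - \<xi> n" "- (- \<eta> / 2 - \<xi> n) = \<xi> n + \<eta> / 2" by simp_all
  have "monodromy_hat \<eta> \<xi> N (- \<eta> / 2 - \<xi> n) = (-1) ^ N \<cdot>\<^sub>m ?C"
    unfolding monodromy_hat_def crossing_def arg E_def[symmetric] ..
  then have "aux_entry N (gauged_monodromy_hat \<eta> \<xi> N (- \<eta> / 2 - \<xi> n) (\<alpha>, \<beta>) (\<gamma>, \<delta>)) j i
      = aux_entry N (site_op N E 0 ?A * ((-1) ^ N \<cdot>\<^sub>m ?C) * site_op N E 0 ?B) j i"
    unfolding gauged_monodromy_hat_def prod.case arg E_def[symmetric] by simp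
  also have "\<dots> = (-1) ^ N \<cdot>\<^sub>m aux_entry N (site_op N E 0 ?A * ?C * site_op N E 0 ?B) j i"
    using ij by (simp add: mult_smult_assoc_mat[of _ E E _ E] mult_smult_distrib[of _ E E _ E] aux_entry_smult)
  also have "\<dots> = (-1) ^ N \<cdot>\<^sub>m (\<tau>' n \<cdot>\<^sub>m (Li n * site_op N D n (?B * elem_mat i j * ?A) * Ki n))"
    by (subst aux_entry_crossing_monodromy[OF n ij(2) ij(1) minv_gauge_carrier[OF \<delta>] gauge_carrier]) (rule refl)
  finally have *: "aux_entry N (gauged_monodromy_hat \<eta> \<xi> N (- \<eta> / 2 - \<xi> n) (\<alpha>, \<beta>) (\<gamma>, \<delta>)) j i
      = ((-1) ^ N * \<tau>' n) \<cdot>\<^sub>m (Li n * site_op N D n (?B * elem_mat i j * ?A) * Ki n)"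
    by (simp only: smult_smult)
  \<comment> \<open>One sign comes from the formula and one from \<open>monodromy_hat\<close>;
    \<open>\<tau>' n\<close> from crossing and \<open>\<tau> n\<close> from the extra transfer
    matrix make up the quantum determinant.\<close>
  have "(-1) ^ N * (1 / detq \<eta> \<xi> N (\<xi> n) * ((-1) ^ N * \<tau>' n) * \<tau> n) = ((-1) ^ N * (-1) ^ N) * (1::complex)"
    using \<tau>_nonzero[OF n] \<tau>'_nonzero[OF n] by (simp add: detq_eq)
  then have s: "(-1) ^ N * (1 / detq \<eta> \<xi> N (\<xi> n) * ((-1) ^ N * \<tau>' n) * \<tau> n) = 1"
    by (simp flip: power_mult_distrib)
  show ?thesis
    unfolding * gauged_elem_eq[OF n \<delta>] smult_smult transfer_reconstruction(2)[OF n] s smult_one ..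
qed

text \<open>The auxiliary entries of a gauge matrix are scalars, so \<open>crossing_mult\<close>
  applies to both products; crossing a gauge matrix gives its adjugate.\<close>

lemma crossing_gauged:
  assumes "M \<in> carrier_mat E E"
  shows "crossing (site_op N E 0 A * M * site_op N E 0 A')
    = site_op N E 0 (adjugate2 A') * crossing M * site_op N E 0 (adjugate2 A)"
proof -
  have comm: "(x \<cdot>\<^sub>m 1\<^sub>m D) * Y = Y * (x \<cdot>\<^sub>m 1\<^sub>m D)" if "Y \<in> carrier_mat D D" for x :: complex and Y
    using that by (simp add: smult_mult)
  have "crossing (site_op N E 0 A * M * site_op N E 0 A') = crossing (site_op N E 0 A') * crossing (site_op N E 0 A * M)"
    using assms by (intro crossing_mult) (auto simp: aux_entry_site_op_0 comm)
  also have "crossing (site_op N E 0 A * M) = crossing M * crossing (site_op N E 0 A)"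
    using assms by (intro crossing_mult) (auto simp: aux_entry_site_op_0 comm)
  finally show ?thesis
    by (simp add: crossing_site_op_0 adjugate2_def)
qed

lemma site_op_smult: "site_op N D n (x \<cdot>\<^sub>m A) = x \<cdot>\<^sub>m site_op N D n A" if "A \<in> carrier_mat 2 2"
  using that by (auto simp: site_op_def intro!: eq_matI)

text \<open>The required entry is, up to sign, the entry \<open>j i\<close> of the crossed gauged
  matrix. There the gauge matrices occur as adjugates, which are the required matrices up to the two
  determinants.\<close>

lemma reconstruction_by_shifted_monodromy:
  assumes n: "n \<in> {1..N}" and ij: "i \<in> {1, 2}" "j \<in> {1, 2}"
    and \<beta>: "sinh (\<eta> * \<beta>) \<noteq> 0" and \<delta>: "sinh (\<eta> * \<delta>) \<noteq> 0"
  shows "gauged_elem \<eta> N n i j (\<xi> n) (\<gamma>, \<delta>) (\<alpha>, \<beta>)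
    = ((-1) powi (int i - int j)
        * (det (gauge \<eta> (- \<xi> n) \<alpha> \<beta>) / det (gauge \<eta> (- \<xi> n) \<gamma> \<delta>))) \<cdot>\<^sub>m
      (transfer_prod \<eta> \<xi> N n
      * ((1 / detq \<eta> \<xi> N (\<xi> n)) \<cdot>\<^sub>m
          aux_entry N (gauged_monodromy \<eta> \<xi> N (\<xi> n + \<eta> / 2) (\<alpha> - 1, \<beta>) (\<gamma> - 1, \<delta>))
            (3 - i) (3 - j))
      * transfer_inv_prod \<eta> \<xi> N (n - 1))"
proof -
  let ?G = "gauge \<eta> (- \<xi> n) \<alpha> \<beta>" and ?H = "gauge \<eta> (- \<xi> n) \<gamma> \<delta>"
  let ?M = "monodromy \<eta> \<xi> N (\<xi> n + \<eta> / 2)"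
  let ?Y = "site_op N E 0 (minv ?G) * ?M * site_op N E 0 ?H"
  let ?S = "site_op N D n (?G * elem_mat i j * minv ?H)"
  let ?e = "(-1) ^ (j + i) :: complex"
  \<comment> \<open>Lowering the first gauge parameter by 1 adds \<open>\<eta>\<close> to the
    exponents and so compensates the argument \<open>- \<xi> n - \<eta>\<close>.\<close>
  have shift: "gauge \<eta> (- \<eta> / 2 - (\<xi> n + \<eta> / 2)) (a - 1) b = gauge \<eta> (- \<xi> n) a b" for a b
    by (simp add: gauge_def algebra_simps add_divide_distrib[symmetric])
  have Y: "gauged_monodromy \<eta> \<xi> N (\<xi> n + \<eta> / 2) (\<alpha> - 1, \<beta>) (\<gamma> - 1, \<delta>) = ?Y"
    unfolding gauged_monodromy_def prod.case shift E_def[symmetric] ..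
  have M: "?M \<in> carrier_mat E E"
    unfolding monodromy_eq by (intro mat_prod_carrier) auto
  have d: "det ?G \<noteq> 0" "det ?H \<noteq> 0" using \<beta> \<delta> by (simp_all add: det_gauge)
  have adj: "adjugate2 ?H = det ?H \<cdot>\<^sub>m minv ?H" "adjugate2 (minv ?G) = (1 / det ?G) \<cdot>\<^sub>m ?G"
  proof -
    show "adjugate2 ?H = det ?H \<cdot>\<^sub>m minv ?H"
      using d by (auto simp: minv_2(1) intro!: eq_matI)
    show "adjugate2 (minv ?G) = (1 / det ?G) \<cdot>\<^sub>m ?G"
      using d by (intro minv_2(2)) simp_all
  qed
  have "adjugate2 (minv ?G) * elem_mat i j * adjugate2 ?H = (det ?H / det ?G) \<cdot>\<^sub>m (?G * elem_mat i j * minv ?H)"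
    unfolding adj using minv_gauge_carrier[OF \<delta>]
    by (simp add: mult_smult_assoc_mat[of _ 2 2 _ 2] mult_smult_distrib[of _ 2 2 _ 2]
      mult_carrier_mat[of _ 2 2 _ 2] smult_smult)
  then have S: "site_op N D n (adjugate2 (minv ?G) * elem_mat i j * adjugate2 ?H) = (det ?H / det ?G) \<cdot>\<^sub>m ?S"
    using minv_gauge_carrier[OF \<delta>] by (simp add: site_op_smult mult_carrier_mat[of _ 2 2 _ 2])
  have "?e \<cdot>\<^sub>m aux_entry N ?Y (3 - i) (3 - j) = aux_entry N (crossing ?Y) j i"
    using ij by (simp add: aux_entry_crossing)
  also have "\<dots> = \<tau>' n \<cdot>\<^sub>m (Li n * site_op N D n (adjugate2 (minv ?G) * elem_mat i j * adjugate2 ?H) * Ki n)"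
    unfolding crossing_gauged[OF M]
    by (rule aux_entry_crossing_monodromy[OF n ij(2) ij(1)]) simp_all
  also have "\<dots> = (\<tau>' n * (det ?H / det ?G)) \<cdot>\<^sub>m (Li n * ?S * Ki n)"
    unfolding S by (simp add: smult_mult smult_smult)
  finally have "?e \<cdot>\<^sub>m (?e \<cdot>\<^sub>m aux_entry N ?Y (3 - i) (3 - j))
      = ?e \<cdot>\<^sub>m ((\<tau>' n * (det ?H / det ?G)) \<cdot>\<^sub>m (Li n * ?S * Ki n))" by simp
  moreover have ee: "?e * ?e = 1" by (simp flip: power_mult_distrib)
  ultimately have *: "aux_entry N ?Y (3 - i) (3 - j)
      = (?e * (\<tau>' n * (det ?H / det ?G))) \<cdot>\<^sub>m (Li n * ?S * Ki n)"
    by (simp only: smult_smult ee smult_one)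
  \<comment> \<open>\<open>int i - int j\<close> may be negative; it has the parity of
    \<open>j + i\<close>.\<close>
  have e: "(-1) powi (int i - int j) = ?e"
    using ij by (auto simp: power_int_def)
  have "?e * (det ?G / det ?H) * (1 / detq \<eta> \<xi> N (\<xi> n) * (?e * (\<tau>' n * (det ?H / det ?G))) * \<tau> n) = ?e * ?e"
    using \<tau>_nonzero[OF n] \<tau>'_nonzero[OF n] d by (simp add: detq_eq)
  then have s: "?e * (det ?G / det ?H) * (1 / detq \<eta> \<xi> N (\<xi> n) * (?e * (\<tau>' n * (det ?H / det ?G))) * \<tau> n) = 1"
    using ee by simp
  show ?thesis
    unfolding Y * e gauged_elem_eq[OF n \<delta>] smult_smult transfer_reconstruction(2)[OF n] s smult_one ..
qed

end

theorem proposition4p1: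
  fixes \<eta> \<alpha> \<beta> \<gamma> \<delta> :: complex and \<xi> :: "nat \<Rightarrow> complex" and N n i j :: nat
  assumes "N \<ge> 1"
    and "sinh \<eta> \<noteq> 0"
    and "generic_inhom \<eta> \<xi> N"
    and "sinh (\<eta> * \<beta>) \<noteq> 0"
    and "sinh (\<eta> * \<delta>) \<noteq> 0"
    and "n \<in> {1..N}"
    and "i \<in> {1, 2}"
    and "j \<in> {1, 2}"
  shows "(\<forall>k\<in>{1..N}. invertible_mat (transfer \<eta> \<xi> N (\<xi> k - \<eta> / 2)))
    \<and> detq \<eta> \<xi> N (\<xi> n) \<noteq> 0
    \<and> gauged_elem \<eta> N n i j (\<xi> n) (\<alpha>, \<beta>) (\<gamma>, \<delta>)
        = transfer_prod \<eta> \<xi> N (n - 1)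
          * aux_entry N (gauged_monodromy \<eta> \<xi> N (\<xi> n - \<eta> / 2) (\<alpha>, \<beta>) (\<gamma>, \<delta>)) j i
          * transfer_inv_prod \<eta> \<xi> N n
    \<and> gauged_elem \<eta> N n i j (\<xi> n) (\<gamma>, \<delta>) (\<alpha>, \<beta>)
        = (-1) ^ N \<cdot>\<^sub>m (transfer_prod \<eta> \<xi> N n
          * ((1 / detq \<eta> \<xi> N (\<xi> n)) \<cdot>\<^sub>m
              aux_entry N (gauged_monodromy_hat \<eta> \<xi> N (- \<eta> / 2 - \<xi> n) (\<alpha>, \<beta>) (\<gamma>, \<delta>)) j i)
          * transfer_inv_prod \<eta> \<xi> N (n - 1))
    \<and> gauged_elem \<eta> N n i j (\<xi> n) (\<gamma>, \<delta>) (\<alpha>, \<beta>)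
        = ((-1) powi (int i - int j)
            * (det (gauge \<eta> (- \<xi> n) \<alpha> \<beta>) / det (gauge \<eta> (- \<xi> n) \<gamma> \<delta>))) \<cdot>\<^sub>m
          (transfer_prod \<eta> \<xi> N n
          * ((1 / detq \<eta> \<xi> N (\<xi> n)) \<cdot>\<^sub>m
              aux_entry N (gauged_monodromy \<eta> \<xi> N (\<xi> n + \<eta> / 2) (\<alpha> - 1, \<beta>) (\<gamma> - 1, \<delta>))
                (3 - i) (3 - j))
          * transfer_inv_prod \<eta> \<xi> N (n - 1))"
proof -
  interpret inhomogeneous_chain N "2 ^ N" "2 ^ (N + 1)" \<eta> \<xi>
  proof unfold_locales
    fix j k assume jk: "j \<in> {1..N}" "k \<in> {1..N}"
    show "sinh (\<xi> j - \<xi> k - \<eta>) \<noteq> 0"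
    \<comment> \<open>For equal sites the value is \<open>- sinh \<eta>\<close>; otherwise a zero
      would put \<open>\<xi> j - \<xi> k\<close> in \<eta> + \<i>\<pi>\<int>.\<close>
    proof (cases "j = k")
      case True
      then show ?thesis using assms(2) by simp
    next
      case False
      then have "\<xi> j - \<xi> k \<notin> excluded \<eta>"
        using assms(3) jk by (simp add: generic_inhom_def)
      then show ?thesis by (rule sinh_nonzero_if_not_excluded) simp
    qed
  qed simp_all
  show ?thesis
  proof (intro conjI ballI)
    \<comment> \<open>This and the next claim ensure that the inverses and the quotient in the
      formulas have their usual meaning.\<close>
    show "invertible_mat (transfer \<eta> \<xi> N (\<xi> k - \<eta> / 2))" if "k \<in> {1..N}" for k
      using that by (rule transfer_inverse)
    show "detq \<eta> \<xi> N (\<xi> n) \<noteq> 0"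
      unfolding detq_eq using \<tau>_nonzero[OF assms(6)] \<tau>'_nonzero[OF assms(6)] by simp
  qed (rule reconstruction_by_monodromy reconstruction_by_monodromy_hat
    reconstruction_by_shifted_monodromy; fact)+
qed

end
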